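(* Let $f(x_1,\dots,x_n)$ be a real analytic (real-valued) function on a neighborhood of a closed ball $\bar B(0,r)\subset\mathbb{R}^n$ centered at the origin. Then there are a positive integer $p$ and a function $A(x_1,\dots,x_{n-1})$, depending on $f$ and $r$, such that the following holds for every $C^1$ function $\phi(x_1,\dots,x_n)$ supported in $B(0,r)$. For real $\lambda \neq 0$, define (as a function of $(x_1,\dots,x_{n-1})$) $$I(\lambda)=\int_{\mathbb{R}} e^{i\lambda f(x_1,\dots,x_n)}\phi(x_1,\dots,x_n)\,dx_n .$$ Then for all $(x_1,\dots,x_{n-1})$, either $f(x_1,\dots,x_n)$ is constant in $x_n$, or for all real $\lambda\neq 0$ $$|I(\lambda)|\le A(x_1,\dots,x_{n-1})\left(\sup_{x_n}|\phi(x_1,\dots,x_n)|+\int_{\mathbb{R}}|\partial_{x_n}\phi(x_1,\dots,x_n)|\,dx_n\right)|\lambda|^{-1/p}.$$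
   Context: $B(0,r)$ is the open ball of radius $r$ centered at the origin in $\mathbb{R}^n$. The integrand defining $I(\lambda)$ is taken to be zero where $\phi$ vanishes (in particular outside $B(0,r)$). "Constant in $x_n$" means constant on the segment $\{x_n:(x_1,\dots,x_n)\in B(0,r)\}$. The function $A$ is finite-valued and independent of $\phi$ and $\lambda$. *)

theory Defs
  imports "HOL-Analysis.Analysis"
begin

text \<open>
  Points of n-space are vectors \<open>x :: real^'n\<close>; the coordinate singled out as the last one is an
  arbitrary index \<open>k :: 'n\<close>. A function of the remaining n - 1 coordinates is represented as a
  function on \<open>real^'n\<close> that is invariant under \<open>set_coord k\<close>. This keeps the case n = 1, where
  there are no remaining coordinates.
\<close>

definition set_coord :: "'n \<Rightarrow> real \<Rightarrow> real^'n \<Rightarrow> real^'n" where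
  "set_coord k t x = (\<chi> i. if i = k then t else x $ i)"

text \<open>Multi-indices are functions \<open>m :: 'n \<Rightarrow> nat\<close>; the sum is unordered, i.e. absolutely convergent.\<close>

definition real_analytic_on :: "(real^'n \<Rightarrow> real) \<Rightarrow> (real^'n) set \<Rightarrow> bool" where
  "real_analytic_on f U \<longleftrightarrow>
     (\<forall>a\<in>U. \<exists>c :: ('n \<Rightarrow> nat) \<Rightarrow> real. \<exists>\<rho>>0. \<forall>x\<in>ball a \<rho>.
        ((\<lambda>m. c m * (\<Prod>i\<in>UNIV. (x $ i - a $ i) ^ m i)) has_sum f x) UNIV)"

definition C1_function :: "('a::real_normed_vector \<Rightarrow> 'b::real_normed_vector) \<Rightarrow> bool" where
  "C1_function g \<longleftrightarrow>
     (\<exists>g' :: 'a \<Rightarrow> ('a \<Rightarrow>\<^sub>L 'b).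
        (\<forall>x. (g has_derivative blinfun_apply (g' x)) (at x)) \<and> continuous_on UNIV g')"

definition partial_deriv ::
    "'n \<Rightarrow> (real^'n \<Rightarrow> 'b::real_normed_vector) \<Rightarrow> real^'n \<Rightarrow> 'b" where
  "partial_deriv k g x = vector_derivative (\<lambda>t. g (set_coord k t x)) (at (x $ k))"

text \<open>The integrand is 0 wherever \<open>\<phi>\<close> vanishes, whatever value \<open>f\<close> takes there.\<close>

definition osc_integral ::
    "'n \<Rightarrow> (real^'n \<Rightarrow> real) \<Rightarrow> (real^'n \<Rightarrow> complex) \<Rightarrow> real \<Rightarrow> real^'n \<Rightarrow> complex" where
  "osc_integral k f \<phi> lam x =
     (LINT t|lborel. exp (\<i> * complex_of_real (lam * f (set_coord k t x))) * \<phi> (set_coord k t x))"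

end

theory Submission
  imports Defs "HOL-Library.Function_Algebras" "HOL-Computational_Algebra.Primes"
begin

text \<open>
  The exponent is uniform because of a Noetherian argument. Near a point of the closed ball, the Taylor
  coefficients of \<open>f\<close> in the direction \<open>k\<close>, of order at least 1, are convergent power series; by a
  division with respect to a finite standard basis (which exists by Dickson's lemma), their common
  zeros are already the common zeros of the first \<open>p\<close> of them. By compactness one \<open>p\<close> serves the whole
  closed ball, so that on every line on which \<open>f\<close> is not constant, \<open>f - f(t0)\<close> vanishes at \<open>t0\<close> to an
  order \<open>j\<close> between 1 and \<open>p\<close>. There the derivative is \<open>h^(j-1)\<close> times a unit, and
  cutting at \<open>h = \<bar>lam\<bar>^(-1/j)\<close> and integrating by parts gives decay \<open>\<bar>lam\<bar>^(-1/j)\<close> for all integrals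
  of the phase over short intervals. Finitely many such intervals cover the segment, and a last
  integration by parts moves the derivative to the amplitude.
\<close>

section \<open>Power series in several variables\<close>

text \<open>The obstacle sits at points where all Taylor coefficients of order at least 1 vanish:
  lines arbitrarily close to such a point may be nonconstant, with coefficients that tend to 0
  there, so no continuity argument bounds the order of vanishing near it. For the same reason no
  bound on A is sought: it is chosen line by line, and only p has to be uniform. A bare ascending
  chain of ideals of germs would express each coefficient by the first p of them on a neighbourhood
  that may shrink with the order. Division removes this defect: p and the polydisc are fixed by the
  finite standard basis, before the coefficient to be divided is chosen. The quotients never have to
  be named; what is kept of them is that the resulting combination q vanishes wherever the basis
  does.\<close>

lemma exists_mono_subseq_nat:
  fixes s :: "nat \<Rightarrow> nat"
  shows "\<exists>\<phi>::nat \<Rightarrow> nat. strict_mono \<phi> \<and> mono (\<lambda>k. s (\<phi> k))"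
proof -
  obtain \<phi> :: "nat \<Rightarrow> nat" where \<phi>: "strict_mono \<phi>" "monoseq (\<lambda>k. s (\<phi> k))"
    using seq_monosub by blast
  show ?thesis
  proof (cases "mono (\<lambda>k. s (\<phi> k))")
    case False
    then have dec: "decseq (\<lambda>k. s (\<phi> k))"
      using \<phi>(2) by (auto simp: monoseq_iff)
    \<comment> \<open>A nonincreasing sequence of naturals is constant from its minimum on, so this
      tail is nondecreasing as well.\<close>
    obtain k0 where k0: "\<And>k. s (\<phi> k0) \<le> s (\<phi> k)"
      using ex_has_least_nat[of "\<lambda>_. True" 0 "\<lambda>k. s (\<phi> k)"] by auto
    have const: "s (\<phi> (k0 + k)) = s (\<phi> k0)" for k
      using k0[of "k0 + k"] decseqD[OF dec, of k0 "k0 + k"] by simp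
    have "strict_mono (\<lambda>k. \<phi> (k0 + k))"
      using \<phi>(1) by (simp add: strict_mono_def)
    then show ?thesis
      using const by (intro exI[of _ "\<lambda>k. \<phi> (k0 + k)"]) (auto simp: mono_def)
  qed (use \<phi> in blast)
qed

lemma exists_mono_subseq:
  fixes a :: "nat \<Rightarrow> 'i \<Rightarrow> nat"
  assumes "finite I"
  shows "\<exists>\<phi>::nat \<Rightarrow> nat. strict_mono \<phi> \<and> (\<forall>i\<in>I. mono (\<lambda>k. a (\<phi> k) i))"
  using assms
proof induction
  case empty
  then show ?case by (auto intro: exI[of _ id] simp: strict_mono_def)
next
  case (insert i I)
  then obtain \<phi> :: "nat \<Rightarrow> nat" where \<phi>: "strict_mono \<phi>" "\<forall>i\<in>I. mono (\<lambda>k. a (\<phi> k) i)" by blast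
  obtain \<psi> :: "nat \<Rightarrow> nat" where \<psi>: "strict_mono \<psi>" "mono (\<lambda>k. a (\<phi> (\<psi> k)) i)"
    using exists_mono_subseq_nat[of "\<lambda>k. a (\<phi> k) i"] by blast
  have "mono (\<lambda>k. a (\<phi> (\<psi> k)) j)" if "j \<in> I" for j
    using \<phi>(2) that strict_mono_mono[OF \<psi>(1)] unfolding mono_def by blast
  then show ?case
    using \<phi>(1) \<psi> by (intro exI[of _ "\<lambda>k. \<phi> (\<psi> k)"]) (auto simp: strict_mono_def)
qed

text \<open>The minimal elements of E form an antichain; an infinite one would contain, along a
  subsequence monotone in every coordinate, two comparable elements. Descent in the total degree
  finds a minimal element below each m.\<close>

lemma dickson:
  fixes E :: "('n::finite \<Rightarrow> nat) set"
  shows "\<exists>F\<subseteq>E. finite F \<and> (\<forall>m\<in>E. \<exists>e\<in>F. e \<le> m)"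
proof -
  define F where "F = {m\<in>E. \<forall>e\<in>E. e \<le> m \<longrightarrow> e = m}"
  have "finite F"
  proof (rule ccontr)
    assume "infinite F"
    then obtain a :: "nat \<Rightarrow> 'n \<Rightarrow> nat" where a: "inj a" "range a \<subseteq> F"
      using infinite_countable_subset by blast
    obtain \<phi> :: "nat \<Rightarrow> nat" where \<phi>: "strict_mono \<phi>" "\<And>i. mono (\<lambda>k. a (\<phi> k) i)"
      using exists_mono_subseq[of UNIV a] by auto
    have "a (\<phi> 0) \<le> a (\<phi> 1)"
      using \<phi>(2) by (auto simp: le_fun_def mono_def)
    then have "a (\<phi> 0) = a (\<phi> 1)"
      using a(2) unfolding F_def by blast
    then have "\<phi> 0 = \<phi> 1" using a(1) by (auto dest: injD)
    then show False using \<phi>(1) by (metis strict_mono_eq zero_neq_one)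
  qed
  moreover have "\<exists>e\<in>F. e \<le> m" if "m \<in> E" for m
    using that
  proof (induction "\<Sum>i\<in>UNIV. m i" arbitrary: m rule: less_induct)
    case less
    show ?case
    proof (cases "m \<in> F")
      case False
      then obtain e where e: "e \<in> E" "e \<le> m" "e \<noteq> m" using less.prems F_def by blast
      then obtain i where "e i < m i"
        by (metis ext le_fun_def le_neq_implies_less)
      then have "(\<Sum>i\<in>UNIV. e i) < (\<Sum>i\<in>UNIV. m i)"
        using e(2) by (intro sum_strict_mono_ex1) (auto simp: le_fun_def)
      from less.hyps[OF this e(1)] show ?thesis using e(2) order_trans by blast
    qed auto
  qed
  ultimately show ?thesis by (intro exI[of _ F]) (auto simp: F_def)
qed

text \<open>Attaching a prime to every coordinate makes the weight of a monomial a natural number that determines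
  it, so that monomials are totally ordered, compatibly with multiplication. For the norms
  \<open>\<Sum>m. \<bar>c m\<bar> * (1 / wt m) ^ s\<close> the monomial of least weight of a given series dominates
  once \<open>s\<close> is large.\<close>

definition coord_prime :: "'n::finite \<Rightarrow> nat" where
  "coord_prime = (SOME P. inj P \<and> range P \<subseteq> {p. prime p})"

lemma coord_prime: "inj (coord_prime :: 'n::finite \<Rightarrow> nat)" "prime (coord_prime (i::'n))"
proof -
  obtain S where S: "S \<subseteq> {p::nat. prime p}" "finite S" "card S = CARD('n)"
    using infinite_arbitrarily_large[OF primes_infinite] by blast
  obtain P :: "'n \<Rightarrow> nat" where "bij_betw P UNIV S"
    using finite_same_card_bij[of "UNIV :: 'n set" S] S by auto
  then have "\<exists>P::'n \<Rightarrow> nat. inj P \<and> range P \<subseteq> {p. prime p}"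
    using S(1) by (auto simp: bij_betw_def)
  from someI_ex[OF this] show "inj (coord_prime :: 'n \<Rightarrow> nat)" "prime (coord_prime (i::'n))"
    unfolding coord_prime_def[symmetric] by auto
qed

definition wt :: "('n::finite \<Rightarrow> nat) \<Rightarrow> nat" where
  "wt m = (\<Prod>i\<in>UNIV. coord_prime i ^ m i)"

lemma coord_prime_ge2: "coord_prime i \<ge> 2"
  using coord_prime(2) prime_ge_2_nat by blast

lemma wt_pos: "wt m > 0"
  unfolding wt_def by (intro prod_pos) (simp add: prime_gt_0_nat coord_prime(2))

lemma wt_add: "wt (m + n) = wt m * wt n"
  by (simp add: wt_def power_add prod.distrib)

text \<open>Unique factorisation: m i is the multiplicity in \<open>wt m\<close> of the prime
  attached to i.\<close>

lemma inj_wt: "inj wt"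
proof (rule injI, rule ext)
  fix m n :: "'n::finite \<Rightarrow> nat" and i
  assume eq: "wt m = wt n"
  have mult: "multiplicity (coord_prime i) (wt m) = m i" for m :: "'n \<Rightarrow> nat"
  proof -
    have "wt m = (\<Prod>p\<in>range (coord_prime :: 'n \<Rightarrow> nat). p ^ m (inv coord_prime p))"
      unfolding wt_def by (subst prod.reindex) (simp_all add: coord_prime(1))
    then show ?thesis
      by (simp only:) (subst multiplicity_prod_prime_powers, auto simp: coord_prime)
  qed
  from mult[of m] mult[of n] eq show "m i = n i" by simp
qed

text \<open>Only finitely many monomials lie below a given weight, so the sums in a triangular
  system ordered by weight are finite.\<close>

lemma finite_wt_le: "finite {m. wt m \<le> N}"
  using finite_vimageI[OF finite_atMost[of N] inj_wt] by (simp add: vimage_def)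

text \<open>Solved by recursion on \<open>w\<close>; the weighted norm \<open>S\<close> of any truncation of the solution satisfies
  \<open>S \<le> H + S / 2\<close>, where \<open>H\<close> is the norm of \<open>h\<close>.\<close>

lemma triangular_system_l1:
  fixes w :: "'a \<Rightarrow> nat" and v :: "'a \<Rightarrow> real" and d :: "'a \<Rightarrow> 'a \<Rightarrow> real"
  assumes w: "\<And>N. finite {m. w m \<le> N}" and v: "\<And>m. v m > 0"
    and diag: "\<And>l. l \<in> L \<Longrightarrow> d l l = 1"
    and triangular: "\<And>l m. l \<in> L \<Longrightarrow> w m \<le> w l \<Longrightarrow> m \<noteq> l \<Longrightarrow> d l m = 0"
    and d_sum: "\<And>l. l \<in> L \<Longrightarrow> (\<lambda>m. \<bar>d l m\<bar> * v m) summable_on - {l}"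
    and d_half: "\<And>l. l \<in> L \<Longrightarrow> (\<Sum>\<^sub>\<infinity>m\<in>-{l}. \<bar>d l m\<bar> * v m) \<le> v l / 2"
    and h: "(\<lambda>m. \<bar>h m\<bar> * v m) summable_on UNIV"
  obtains u where "\<And>m. m \<notin> L \<Longrightarrow> u m = 0" "(\<lambda>m. \<bar>u m\<bar> * v m) summable_on UNIV"
    "\<And>m. m \<in> L \<Longrightarrow> (\<Sum>l | w l \<le> w m. u l * d l m) = h m"
proof -
  have v0: "0 \<le> v m" for m using v[of m] by simp
  define R where "R = (\<lambda>u m. if m \<in> L then h m - (\<Sum>l | w l < w m. u l * d l m) else 0)"
  have "adm_wf (inv_image less_than w) R"
    unfolding adm_wf_def R_def by (auto intro!: sum.cong)
  define u where "u = wfrec (inv_image less_than w) R"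
  have "u = R u"
    unfolding u_def by (rule wfrec_fixpoint) (use \<open>adm_wf _ _\<close> in auto)
  then have u: "u m = (if m \<in> L then h m - (\<Sum>l | w l < w m. u l * d l m) else 0)" for m
    unfolding R_def by meson
  have supp: "u m = 0" if "m \<notin> L" for m using u[of m] that by simp
  have fin: "finite {l. w l < N}" for N
    by (rule finite_subset[OF _ w[of N]]) auto
  have solves: "(\<Sum>l | w l \<le> w m. u l * d l m) = h m" if "m \<in> L" for m
  proof -
    \<comment> \<open>Here w need not be injective. Other indices of the same weight as m contribute
      nothing: by \<open>triangular\<close> if they lie in L, by \<open>supp\<close> if not.\<close>
    have "(\<Sum>l | w l \<le> w m. u l * d l m) = (\<Sum>l\<in>insert m {l. w l < w m}. u l * d l m)"
      using supp triangular w by (intro sum.mono_neutral_right) (auto, metis less_or_eq_imp_le linorder_neqE_nat)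
    then show ?thesis using u[of m] that diag fin by simp
  qed
  define H where "H = (\<Sum>\<^sub>\<infinity>m. \<bar>h m\<bar> * v m)"
  have bound: "(\<Sum>m | w m \<le> N. \<bar>u m\<bar> * v m) \<le> 2 * H" for N
  proof -
    let ?W = "{m. w m \<le> N}"
    have "(\<Sum>m\<in>?W. \<bar>u m\<bar> * v m) \<le> (\<Sum>m\<in>?W. \<bar>h m\<bar> * v m + (\<Sum>l | w l < w m. \<bar>u l\<bar> * (\<bar>d l m\<bar> * v m)))"
    proof (rule sum_mono)
      fix m
      have "\<bar>u m\<bar> \<le> \<bar>h m\<bar> + (\<Sum>l | w l < w m. \<bar>u l\<bar> * \<bar>d l m\<bar>)"
        using u[of m] sum_abs[of "\<lambda>l. u l * d l m" "{l. w l < w m}"]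
        by (cases "m \<in> L") (auto simp: abs_mult sum_nonneg add_nonneg_nonneg)
      from mult_right_mono[OF this less_imp_le[OF v[of m]]]
      show "\<bar>u m\<bar> * v m \<le> \<bar>h m\<bar> * v m + (\<Sum>l | w l < w m. \<bar>u l\<bar> * (\<bar>d l m\<bar> * v m))"
        by (simp add: algebra_simps sum_distrib_left)
    qed
    also have "\<dots> = (\<Sum>m\<in>?W. \<bar>h m\<bar> * v m) + (\<Sum>m\<in>?W. (\<Sum>l | w l < w m. \<bar>u l\<bar> * (\<bar>d l m\<bar> * v m)))"
      by (rule sum.distrib)
    also have "(\<Sum>m\<in>?W. \<bar>h m\<bar> * v m) \<le> H"
      unfolding H_def using v0 h w by (intro finite_sum_le_infsum) auto
    also have "(\<Sum>m\<in>?W. (\<Sum>l | w l < w m. \<bar>u l\<bar> * (\<bar>d l m\<bar> * v m)))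
        = (\<Sum>m\<in>?W. (\<Sum>l\<in>?W. if w l < w m then \<bar>u l\<bar> * (\<bar>d l m\<bar> * v m) else 0))"
      using w by (intro sum.cong refl sum.mono_neutral_cong_left) auto
    also have "\<dots> = (\<Sum>l\<in>?W. (\<Sum>m\<in>?W. if w l < w m then \<bar>u l\<bar> * (\<bar>d l m\<bar> * v m) else 0))"
      by (rule sum.swap)
    \<comment> \<open>For fixed l the off-diagonal entries have norm at most v l / 2, so each
      unknown is charged at most half of its own contribution. The truncated sum is finite, hence it
      can absorb this half.\<close>
    also have "\<dots> \<le> (\<Sum>l\<in>?W. \<bar>u l\<bar> * (v l / 2))"
    proof (rule sum_mono)
      fix l
      show "(\<Sum>m\<in>?W. if w l < w m then \<bar>u l\<bar> * (\<bar>d l m\<bar> * v m) else 0) \<le> \<bar>u l\<bar> * (v l / 2)"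
      proof (cases "l \<in> L")
        case True
        have "(\<Sum>m\<in>?W. if w l < w m then \<bar>u l\<bar> * (\<bar>d l m\<bar> * v m) else 0)
            = \<bar>u l\<bar> * (\<Sum>m\<in>?W \<inter> {m. w l < w m}. \<bar>d l m\<bar> * v m)"
          using w by (simp add: sum.inter_restrict sum_distrib_left if_distrib cong: if_cong)
        also have "(\<Sum>m\<in>?W \<inter> {m. w l < w m}. \<bar>d l m\<bar> * v m) \<le> (\<Sum>\<^sub>\<infinity>m\<in>-{l}. \<bar>d l m\<bar> * v m)"
          using w d_sum[OF True] v0 by (intro finite_sum_le_infsum) auto
        also have "\<dots> \<le> v l / 2" by (rule d_half[OF True])
        finally show ?thesis by (simp add: mult_left_mono)
      qed (simp add: supp cong: if_cong)
    qed
    finally show ?thesis by (simp add: sum_distrib_left[symmetric] sum_divide_distrib[symmetric])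
  qed
  have "(\<lambda>m. \<bar>u m\<bar> * v m) summable_on UNIV"
  proof (rule nonneg_bdd_above_summable_on)
    show "bdd_above (sum (\<lambda>m. \<bar>u m\<bar> * v m) ` {F. F \<subseteq> UNIV \<and> finite F})"
    proof (rule bdd_aboveI2)
      fix F assume F: "F \<in> {F. F \<subseteq> (UNIV::'a set) \<and> finite F}"
      have "F \<subseteq> {m. w m \<le> Max (w ` F)}" using F by auto
      then have "(\<Sum>m\<in>F. \<bar>u m\<bar> * v m) \<le> (\<Sum>m | w m \<le> Max (w ` F). \<bar>u m\<bar> * v m)"
        using w v0 by (intro sum_mono2) auto
      also have "\<dots> \<le> 2 * H" by (rule bound)
      finally show "(\<Sum>m\<in>F. \<bar>u m\<bar> * v m) \<le> 2 * H" .
    qed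
  qed (use v0 in auto)
  then show ?thesis using that supp solves by blast
qed

section \<open>Weighted norms, convergence on polydiscs, and division\<close>

text \<open>The value of the monomial m at the corner of \<open>polydisc s\<close>, whose
  coordinates are the attached primes to the power -s. So \<open>wsummable s\<close> is absolute
  convergence at that corner, hence on the whole polydisc, and raising s shrinks the
  polydisc.\<close>

definition wweight :: "nat \<Rightarrow> ('n::finite \<Rightarrow> nat) \<Rightarrow> real" where
  "wweight s m = (1 / real (wt m)) ^ s"

definition wsummable :: "nat \<Rightarrow> (('n::finite \<Rightarrow> nat) \<Rightarrow> real) \<Rightarrow> bool" where
  "wsummable s c \<longleftrightarrow> (\<lambda>m. \<bar>c m\<bar> * wweight s m) summable_on UNIV"

definition polydisc :: "nat \<Rightarrow> (real^'n) set" where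
  "polydisc s = {y. \<forall>i. \<bar>y $ i\<bar> \<le> (1 / real (coord_prime i)) ^ s}"

definition monom_at :: "real^'n \<Rightarrow> ('n \<Rightarrow> nat) \<Rightarrow> real" where
  "monom_at y m = (\<Prod>i\<in>UNIV. y $ i ^ m i)"

definition mseries :: "(('n \<Rightarrow> nat) \<Rightarrow> real) \<Rightarrow> real^'n \<Rightarrow> real" where
  "mseries c y = (\<Sum>\<^sub>\<infinity>m. c m * monom_at y m)"

lemma wweight_pos: "wweight s m > 0"
  by (simp add: wweight_def wt_pos)

lemma wweight_nonneg [simp]: "0 \<le> wweight s m"
  using wweight_pos[of s m] by simp

lemma wweight_add: "wweight s (m + n) = wweight s m * wweight s n"
  by (simp add: wweight_def wt_add power_mult_distrib power_divide)

lemma wweight_add_exponent: "wweight (s + t) m = wweight s m * wweight t m"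
  by (simp add: wweight_def power_add)

lemma wweight_antimono: "s \<le> t \<Longrightarrow> wweight t m \<le> wweight s m"
  using wt_pos[of m] by (auto simp: wweight_def Suc_leI intro!: power_decreasing)

lemma wsummable_mono: "wsummable s c \<Longrightarrow> s \<le> t \<Longrightarrow> wsummable t c"
  unfolding wsummable_def
  by (erule summable_on_comparison_test) (auto intro!: mult_left_mono wweight_antimono)

lemma polydisc_antimono:
  assumes "s \<le> t"
  shows "polydisc t \<subseteq> (polydisc s :: (real^'n) set)"
proof -
  have "(1 / real (coord_prime (i::'n))) ^ t \<le> (1 / real (coord_prime i)) ^ s" for i
    using assms coord_prime_ge2[of i] by (intro power_decreasing) auto
  then show ?thesis unfolding polydisc_def by (blast intro: order_trans)
qed

lemma monom_at_add: "monom_at y (m + n) = monom_at y m * monom_at y n"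
  by (simp add: monom_at_def power_add prod.distrib)

lemma abs_monom_at_le:
  assumes "y \<in> polydisc s"
  shows "\<bar>monom_at y m\<bar> \<le> wweight s m"
proof -
  have "\<bar>monom_at y m\<bar> = (\<Prod>i\<in>UNIV. \<bar>y $ i\<bar> ^ m i)"
    by (simp add: monom_at_def abs_prod power_abs)
  also have "\<dots> \<le> (\<Prod>i\<in>UNIV. ((1 / real (coord_prime i)) ^ s) ^ m i)"
    using assms by (intro prod_mono conjI power_mono) (auto simp: polydisc_def)
  also have "\<dots> = (\<Prod>i\<in>UNIV. (1 / real (coord_prime i) ^ m i) ^ s)"
    by (simp add: power_divide mult.commute flip: power_mult)
  also have "\<dots> = wweight s m"
    by (simp add: wweight_def wt_def prod_power_distrib[symmetric] prod_dividef)
  finally show ?thesis .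
qed

lemma wsummable_imp_summable:
  assumes "wsummable s c" "y \<in> polydisc s"
  shows "(\<lambda>m. \<bar>c m * monom_at y m\<bar>) summable_on UNIV" "(\<lambda>m. c m * monom_at y m) summable_on UNIV"
proof -
  show "(\<lambda>m. \<bar>c m * monom_at y m\<bar>) summable_on UNIV"
    using assms(1) unfolding wsummable_def
    by (rule summable_on_comparison_test)
      (auto simp: abs_mult intro!: mult_left_mono abs_monom_at_le[OF assms(2)])
  then show "(\<lambda>m. c m * monom_at y m) summable_on UNIV"
    by (subst summable_on_iff_abs_summable_on_real) simp
qed

text \<open>Used for the rows of the division system: each is a monomial times a basis series, so it
  vanishes wherever that series does.\<close>

lemma mseries_shift:
  assumes d: "\<And>m. d m = (if n \<le> m then c (m - n) else 0)"
  shows "mseries d y = monom_at y n * mseries c y"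
proof -
  have "mseries d y = (\<Sum>\<^sub>\<infinity>m\<in>range (\<lambda>m. m + n). d m * monom_at y m)"
    unfolding mseries_def
  proof (rule infsum_cong_neutral)
    fix m assume "m \<in> UNIV - range (\<lambda>m. m + n)"
    moreover have "m \<in> range (\<lambda>m. m + n)" if "n \<le> m"
      using that by (intro image_eqI[of _ _ "m - n"]) (auto simp: fun_eq_iff le_fun_def)
    ultimately have "\<not> n \<le> m" by blast
    then show "d m * monom_at y m = 0" by (simp add: d[of m])
  qed auto
  also have "\<dots> = (\<Sum>\<^sub>\<infinity>m. d (m + n) * monom_at y (m + n))"
    by (subst infsum_reindex) (simp_all add: inj_on_def fun_eq_iff o_def)
  also have "\<dots> = (\<Sum>\<^sub>\<infinity>m. monom_at y n * (c m * monom_at y m))"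
  proof (rule infsum_cong)
    fix m
    have "n \<le> m + n" "m + n - n = m" by (simp_all add: le_fun_def fun_eq_iff)
    then show "d (m + n) * monom_at y (m + n) = monom_at y n * (c m * monom_at y m)"
      by (simp only: d monom_at_add if_True) simp
  qed
  finally show ?thesis by (simp add: mseries_def infsum_cmult_right')
qed

text \<open>Weights are distinct integers, so every other monomial that occurs weighs at least
  \<open>wt e + 1\<close>. Raising s by t multiplies its term by at most (1 / (wt e + 1))^t, while
  the weight of e only shrinks by (1 / wt e)^t; the quotient tends to 0 geometrically.\<close>

lemma leading_coeff_dominates:
  assumes c: "wsummable s0 c" and small: "\<And>m. wt m < wt e \<Longrightarrow> c m = 0"
  shows "\<forall>\<^sub>F s in sequentially. (\<lambda>m. \<bar>c m\<bar> * wweight s m) summable_on - {e}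
    \<and> (\<Sum>\<^sub>\<infinity>m\<in>-{e}. \<bar>c m\<bar> * wweight s m) \<le> wweight s e / 2"
proof -
  define M where "M = (\<Sum>\<^sub>\<infinity>m\<in>-{e}. \<bar>c m\<bar> * wweight s0 m)"
  have sums: "(\<lambda>m. \<bar>c m\<bar> * wweight s m) summable_on - {e}" if "s \<ge> s0" for s
    using wsummable_mono[OF c that] unfolding wsummable_def by (rule summable_on_subset) auto
  \<comment> \<open>The ratio of the two decay rates. The factor 2 * M * (wt e)^s0 is chosen so that
    the bound M * (1 / (wt e + 1))^t on the tail is at most \<open>wweight s e / 2\<close> exactly
    when the product is at most 1.\<close>
  let ?q = "real (wt e) / (real (wt e) + 1)"
  have "(\<lambda>t. 2 * M * real (wt e) ^ s0 * ?q ^ t) \<longlonglongrightarrow> 0"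
    by (intro tendsto_mult_right_zero LIMSEQ_power_zero) auto
  then have "\<forall>\<^sub>F t in sequentially. 2 * M * real (wt e) ^ s0 * ?q ^ t < 1"
    by (rule order_tendstoD) simp
  then obtain t0 where t0: "\<And>t. t \<ge> t0 \<Longrightarrow> 2 * M * real (wt e) ^ s0 * ?q ^ t < 1"
    unfolding eventually_sequentially by blast
  show ?thesis
    unfolding eventually_sequentially
  proof (intro exI[of _ "s0 + t0"] allI impI conjI)
    fix s assume s: "s0 + t0 \<le> s"
    define t where "t = s - s0"
    have t: "s = s0 + t" "t \<ge> t0" using s by (auto simp: t_def)
    show "(\<lambda>m. \<bar>c m\<bar> * wweight s m) summable_on - {e}" using sums t by simp
    have we: "real (wt e) > 0" using wt_pos by simp
    have "(\<Sum>\<^sub>\<infinity>m\<in>-{e}. \<bar>c m\<bar> * wweight s m)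
        \<le> (\<Sum>\<^sub>\<infinity>m\<in>-{e}. \<bar>c m\<bar> * wweight s0 m * (1 / (real (wt e) + 1)) ^ t)"
    proof (rule infsum_mono)
      fix m assume m: "m \<in> - {e}"
      show "\<bar>c m\<bar> * wweight s m \<le> \<bar>c m\<bar> * wweight s0 m * (1 / (real (wt e) + 1)) ^ t"
      proof (cases "c m = 0")
        case False
        then have "wt m \<ge> wt e" using small by force
        moreover have "wt m \<noteq> wt e" using m inj_wt by (auto dest: injD)
        ultimately have "real (wt e) + 1 \<le> real (wt m)" by simp
        then have "wweight t m \<le> (1 / (real (wt e) + 1)) ^ t"
          unfolding wweight_def by (intro power_mono) (auto intro!: frac_le)
        then show ?thesis
          unfolding t(1) wweight_add_exponent by (simp add: mult.assoc mult_left_mono)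
      qed simp
    qed (use sums[of s] sums[of s0] t in \<open>auto intro!: summable_on_cmult_left\<close>)
    also have "\<dots> = M * (1 / (real (wt e) + 1)) ^ t"
      by (simp add: M_def infsum_cmult_left')
    also have "\<dots> = (2 * M * real (wt e) ^ s0 * ?q ^ t) * (wweight s e / 2)"
      using we by (simp add: t(1) wweight_def power_add power_divide)
    also have "\<dots> \<le> 1 * (wweight s e / 2)"
      using t0[OF t(2)] by (intro mult_right_mono) auto
    finally show "(\<Sum>\<^sub>\<infinity>m\<in>-{e}. \<bar>c m\<bar> * wweight s m) \<le> wweight s e / 2" by simp
  qed
qed

text \<open>The weight is multiplicative, so multiplying a series by x^n scales its tail and its
  leading term by the same factor. Domination by the leading term thus passes from a basis series to
  all its monomial multiples.\<close>

lemma has_sum_shift_compl: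
  assumes d: "\<And>m. d m = (if n \<le> m then c (m - n) else 0)"
    and S: "((\<lambda>m. \<bar>c m\<bar> * wweight s m) has_sum S) (- {e})"
  shows "((\<lambda>m. \<bar>d m\<bar> * wweight s m) has_sum wweight s n * S) (- {e + n})"
proof -
  let ?A = "(\<lambda>m. m + n) ` (- {e})"
  have "((\<lambda>m. \<bar>d m\<bar> * wweight s m) has_sum wweight s n * S) ?A"
  proof (subst has_sum_reindex)
    have "((\<lambda>m. wweight s n * (\<bar>c m\<bar> * wweight s m)) has_sum wweight s n * S) (- {e})"
      using S by (rule has_sum_cmult_right)
    then show "((\<lambda>m. \<bar>d m\<bar> * wweight s m) \<circ> (\<lambda>m. m + n) has_sum wweight s n * S) (- {e})"
      by (rule has_sum_cong[THEN iffD1, rotated])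
        (auto simp: d wweight_add le_fun_def fun_diff_def algebra_simps)
  qed (auto simp: inj_on_def fun_eq_iff)
  moreover have "\<bar>d m\<bar> * wweight s m = 0" if "m \<in> - {e + n} - ?A" for m
  proof (cases "n \<le> m")
    case True
    then have "m = (m - n) + n" by (auto simp: fun_eq_iff le_fun_def)
    then show ?thesis using that by blast
  qed (simp add: d)
  moreover have "?A \<subseteq> - {e + n}" by (auto simp: fun_eq_iff)
  ultimately show ?thesis
    by (subst has_sum_cong_neutral[where T = ?A and g = "\<lambda>m. \<bar>d m\<bar> * wweight s m"]) auto
qed

text \<open>Division of \<open>h\<close> by the family \<open>C\<close>: the quotients are encoded by the solution \<open>u\<close> of the triangular
  system for the shifted series \<open>x^(l - \<kappa> l) * C (\<kappa> l)\<close>, and \<open>h - q\<close> is the remainder.\<close>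

lemma standard_basis_division:
  fixes C :: "('n::finite \<Rightarrow> nat) \<Rightarrow> ('n \<Rightarrow> nat) \<Rightarrow> real"
  assumes lead: "\<And>e. e \<in> F \<Longrightarrow> C e e = 1" "\<And>e m. e \<in> F \<Longrightarrow> wt m < wt e \<Longrightarrow> C e m = 0"
    and dom: "\<And>e. e \<in> F \<Longrightarrow> (\<lambda>m. \<bar>C e m\<bar> * wweight s m) summable_on - {e}"
      "\<And>e. e \<in> F \<Longrightarrow> (\<Sum>\<^sub>\<infinity>m\<in>-{e}. \<bar>C e m\<bar> * wweight s m) \<le> wweight s e / 2"
    and h: "wsummable s h"
  shows "\<exists>q. wsummable s q \<and> (\<forall>m. \<forall>e\<in>F. e \<le> m \<longrightarrow> q m = h m) \<and>
    (\<forall>y\<in>polydisc s. (\<forall>e\<in>F. mseries (C e) y = 0) \<longrightarrow> mseries q y = 0)"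
proof -
  define L where "L = {m. \<exists>e\<in>F. e \<le> m}"
  \<comment> \<open>For each l in the monomial ideal generated by F, one basis exponent dividing l
    is chosen; \<beta> l is the cofactor. Row l of the system is then x^(\<beta> l) * C (\<kappa>
    l), whose leading monomial is l.\<close>
  define \<kappa> where "\<kappa> m = (SOME e. e \<in> F \<and> e \<le> m)" for m
  have \<kappa>: "\<kappa> m \<in> F" "\<kappa> m \<le> m" if "m \<in> L" for m
    using someI_ex[of "\<lambda>e. e \<in> F \<and> e \<le> m"] that unfolding L_def \<kappa>_def by blast+
  define \<beta> where "\<beta> l = l - \<kappa> l" for l
  have l_eq: "\<kappa> l + \<beta> l = l" if "l \<in> L" for l
    using \<kappa>(2)[OF that] by (auto simp: \<beta>_def fun_eq_iff le_fun_def)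
  define d where "d l m = (if l \<in> L \<and> \<beta> l \<le> m then C (\<kappa> l) (m - \<beta> l) else 0)" for l m
  have d: "d l m = (if \<beta> l \<le> m then C (\<kappa> l) (m - \<beta> l) else 0)" if "l \<in> L" for l m
    using that by (simp add: d_def)
  have diag: "d l l = 1" if "l \<in> L" for l
  proof -
    have "\<beta> l \<le> l" "l - \<beta> l = \<kappa> l"
      using \<kappa>(2)[OF that] by (auto simp: \<beta>_def le_fun_def fun_eq_iff)
    then show ?thesis using lead(1) \<kappa>(1)[OF that] d[OF that] by simp
  qed
  have triangular: "d l m = 0" if "l \<in> L" "wt m \<le> wt l" "m \<noteq> l" for l m
  proof (cases "\<beta> l \<le> m")
    case True
    then have m: "m = (m - \<beta> l) + \<beta> l" by (auto simp: fun_eq_iff le_fun_def)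
    have ne: "m - \<beta> l \<noteq> \<kappa> l" using m l_eq[OF that(1)] that(3) by metis
    \<comment> \<open>Cancelling the weight of the cofactor reduces the comparison of m with l to
      one with the leading exponent of the basis series.\<close>
    have "wt (m - \<beta> l) * wt (\<beta> l) \<le> wt (\<kappa> l) * wt (\<beta> l)"
      using that(2) m l_eq[OF that(1)] by (metis wt_add)
    then have "wt (m - \<beta> l) \<le> wt (\<kappa> l)" using wt_pos[of "\<beta> l"] by simp
    then have "wt (m - \<beta> l) < wt (\<kappa> l)" using ne inj_wt by (metis injD le_neq_implies_less)
    then show ?thesis using d[OF that(1)] lead(2) \<kappa>(1)[OF that(1)] by simp
  qed (simp add: d_def)
  have d_has_sum: "((\<lambda>m. \<bar>d l m\<bar> * wweight s m) has_sum
      wweight s (\<beta> l) * (\<Sum>\<^sub>\<infinity>m\<in>-{\<kappa> l}. \<bar>C (\<kappa> l) m\<bar> * wweight s m)) (- {l})" if "l \<in> L" for l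
    using has_sum_shift_compl[OF d[OF that] has_sum_infsum[OF dom(1)[OF \<kappa>(1)[OF that]]]]
    by (simp add: l_eq that)
  have d_half: "(\<Sum>\<^sub>\<infinity>m\<in>-{l}. \<bar>d l m\<bar> * wweight s m) \<le> wweight s l / 2" if "l \<in> L" for l
  proof -
    have "(\<Sum>\<^sub>\<infinity>m\<in>-{l}. \<bar>d l m\<bar> * wweight s m)
        = wweight s (\<beta> l) * (\<Sum>\<^sub>\<infinity>m\<in>-{\<kappa> l}. \<bar>C (\<kappa> l) m\<bar> * wweight s m)"
      using d_has_sum[OF that] by (rule infsumI)
    also have "\<dots> \<le> wweight s (\<beta> l) * (wweight s (\<kappa> l) / 2)"
      using dom(2) \<kappa>(1)[OF that] by (intro mult_left_mono) auto
    also have "\<dots> = wweight s (\<kappa> l + \<beta> l) / 2" by (simp add: wweight_add)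
    finally show ?thesis using l_eq[OF that] by simp
  qed
  have d_summable: "(\<lambda>m. \<bar>d l m\<bar> * wweight s m) summable_on - {l}" if "l \<in> L" for l
    using d_has_sum[OF that] by (rule has_sum_imp_summable)
  have d_has_sum_UNIV: "((\<lambda>m. \<bar>d l m\<bar> * wweight s m) has_sum
      wweight s l + (\<Sum>\<^sub>\<infinity>m\<in>-{l}. \<bar>d l m\<bar> * wweight s m)) UNIV" if "l \<in> L" for l
    using has_sum_insert[OF _ has_sum_infsum[OF d_summable[OF that]], of l] diag[OF that]
    by (simp add: insert_UNIV Compl_insert)
  obtain u where u: "\<And>m. m \<notin> L \<Longrightarrow> u m = 0" "(\<lambda>m. \<bar>u m\<bar> * wweight s m) summable_on UNIV"
    "\<And>m. m \<in> L \<Longrightarrow> (\<Sum>l | wt l \<le> wt m. u l * d l m) = h m"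
    using triangular_system_l1[of wt "wweight s" L d h] finite_wt_le wweight_pos diag triangular d_half
      d_summable h[unfolded wsummable_def] by blast
  \<comment> \<open>The coefficient at m of the combination of all rows with factors u l. The sum is
    finite because row l has no monomial of weight below \<open>wt l\<close>. The system makes q
    agree with h on L; off L, q takes whatever value results.\<close>
  define q where "q m = (\<Sum>l | wt l \<le> wt m. u l * d l m)" for m
  define D where "D l = (\<Sum>\<^sub>\<infinity>m. \<bar>d l m\<bar> * wweight s m)" for l
  have D: "((\<lambda>m. \<bar>u l\<bar> * (\<bar>d l m\<bar> * wweight s m)) has_sum \<bar>u l\<bar> * D l) UNIV" for l
    using d_has_sum_UNIV[of l] has_sum_imp_summable u(1)[of l] unfolding D_def
    by (cases "l \<in> L") (auto intro!: has_sum_cmult_right has_sum_infsum)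
  have "(\<lambda>l. \<bar>u l\<bar> * D l) summable_on UNIV"
  proof (rule summable_on_comparison_test)
    show "(\<lambda>l. \<bar>u l\<bar> * wweight s l * 2) summable_on UNIV"
      using u(2) by (rule summable_on_cmult_left)
    show "0 \<le> \<bar>u l\<bar> * D l" for l by (simp add: D_def infsum_nonneg)
    show "\<bar>u l\<bar> * D l \<le> \<bar>u l\<bar> * wweight s l * 2" for l
    proof (cases "l \<in> L")
      case True
      have "D l \<le> wweight s l * 2"
        using infsumI[OF d_has_sum_UNIV[OF True]] d_half[OF True] wweight_nonneg[of s l]
        unfolding D_def by linarith
      then show ?thesis by (simp add: mult.assoc mult_left_mono)
    qed (simp add: u(1))
  qed
  \<comment> \<open>Absolute summability of the double family in the weighted norm is what allows
    both orders of summation: over l first to bound the norm of q, and in either order to evaluate q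
    at a point.\<close>
  then have dbl: "(\<lambda>(l, m). \<bar>u l\<bar> * (\<bar>d l m\<bar> * wweight s m)) summable_on UNIV \<times> UNIV"
    by (intro summable_on_SigmaI[where g = "\<lambda>l. \<bar>u l\<bar> * D l"]) (use D in auto)
  have dbl': "(\<lambda>(m, l). \<bar>u l\<bar> * (\<bar>d l m\<bar> * wweight s m)) summable_on UNIV \<times> UNIV"
    using dbl by (subst summable_on_swap) (simp add: case_prod_unfold)
  have row: "((\<lambda>l. u l * d l m * z) has_sum q m * z) UNIV" for m z
  proof -
    have "((\<lambda>l. u l * d l m * z) has_sum q m * z) {l. wt l \<le> wt m}"
      unfolding q_def sum_distrib_right by (rule has_sum_finite[OF finite_wt_le])
    moreover have "u l * d l m = 0" if "\<not> wt l \<le> wt m" for l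
      using triangular[of l m] u(1)[of l] that by (cases "l \<in> L") auto
    ultimately show ?thesis
      by (subst has_sum_cong_neutral[where T = "{l. wt l \<le> wt m}" and g = "\<lambda>l. u l * d l m * z"]) auto
  qed
  have q_sum: "wsummable s q"
    unfolding wsummable_def
  proof (rule summable_on_comparison_test)
    show "(\<lambda>m. \<Sum>\<^sub>\<infinity>l. \<bar>u l\<bar> * (\<bar>d l m\<bar> * wweight s m)) summable_on UNIV"
      using summable_on_Sigma_banach[OF dbl'] by simp
    fix m
    have 1: "(\<lambda>l. \<bar>u l\<bar> * (\<bar>d l m\<bar> * wweight s m)) summable_on UNIV"
      using summable_on_SigmaD1[OF dbl'] by simp
    have "norm (\<Sum>\<^sub>\<infinity>l. u l * d l m * wweight s m) \<le> (\<Sum>\<^sub>\<infinity>l. norm (u l * d l m * wweight s m))"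
      by (rule norm_infsum_bound) (use 1 in \<open>simp add: abs_mult mult.assoc\<close>)
    then show "\<bar>q m\<bar> * wweight s m \<le> (\<Sum>\<^sub>\<infinity>l. \<bar>u l\<bar> * (\<bar>d l m\<bar> * wweight s m))"
      unfolding infsumI[OF row[of m "wweight s m"]] by (simp add: abs_mult mult.assoc)
  qed auto
  have q_zero: "mseries q y = 0" if y: "y \<in> polydisc s" and zero: "\<And>e. e \<in> F \<Longrightarrow> mseries (C e) y = 0" for y
  proof -
    \<comment> \<open>Summed over m first, this family gives multiples of basis series at y, all
      zero; summed over l first, it gives the series q at y.\<close>
    let ?f = "\<lambda>(l, m). u l * d l m * monom_at y m"
    have "(\<lambda>x. \<bar>?f x\<bar>) summable_on UNIV \<times> UNIV"
      using dbl
      by (rule summable_on_comparison_test)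
        (auto simp: abs_mult mult.assoc intro!: mult_left_mono abs_monom_at_le[OF y])
    then have "?f summable_on UNIV \<times> UNIV"
      by (subst summable_on_iff_abs_summable_on_real) simp
    then obtain S where S: "(?f has_sum S) (UNIV \<times> UNIV)" unfolding summable_on_def by blast
    have row0: "((\<lambda>m. ?f (l, m)) has_sum 0) UNIV" for l
    proof (cases "l \<in> L")
      case True
      have "wsummable s (d l)"
        using has_sum_imp_summable[OF d_has_sum_UNIV[OF True]] by (simp add: wsummable_def)
      then have "((\<lambda>m. u l * (d l m * monom_at y m)) has_sum u l * mseries (d l) y) UNIV"
        unfolding mseries_def using wsummable_imp_summable(2)[OF _ y] by (intro has_sum_cmult_right) auto
      moreover have "mseries (d l) y = 0"
        using mseries_shift[OF d[OF True]] zero \<kappa>(1)[OF True] by simp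
      ultimately show ?thesis by (simp add: mult.assoc)
    qed (simp add: u(1))
    have "((\<lambda>l::'n \<Rightarrow> nat. 0) has_sum S) UNIV" by (rule has_sum_SigmaD[OF S]) (rule row0)
    then have "S = 0" using has_sum_0_simp has_sum_unique by blast
    have "((\<lambda>(m, l). u l * d l m * monom_at y m) has_sum S) (UNIV \<times> UNIV)"
      using S by (subst has_sum_swap) (simp add: case_prod_unfold)
    then have "((\<lambda>m. q m * monom_at y m) has_sum S) UNIV"
      by (rule has_sum_SigmaD) (use row in auto)
    then show ?thesis
      using \<open>S = 0\<close> unfolding mseries_def by (simp add: infsumI)
  qed
  have q_eq: "q m = h m" if "e \<in> F" "e \<le> m" for e m
    using u(3)[of m] that unfolding q_def L_def by blast
  show ?thesis
  proof (intro exI[of _ q] conjI allI ballI impI)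
    show "q m = h m" if "e \<in> F" "e \<le> m" for m e using that by (rule q_eq)
    show "mseries q y = 0" if "y \<in> polydisc s" "\<forall>e\<in>F. mseries (C e) y = 0" for y
      using q_zero[OF that(1)] that(2) by simp
  qed (rule q_sum)
qed

text \<open>Noetherianity of the ring of convergent power series, in the only form needed: the series that vanish
  near 0 wherever finitely many of the \<open>g j\<close> do play the role of the ideal.\<close>

lemma common_zeros_finitely_determined:
  fixes g :: "nat \<Rightarrow> ('n::finite \<Rightarrow> nat) \<Rightarrow> real"
  assumes g: "\<And>j. wsummable s0 (g j)"
  shows "\<exists>p s. s0 \<le> s \<and>
    (\<forall>y\<in>polydisc s. (\<forall>i<p. mseries (g i) y = 0) \<longrightarrow> (\<forall>j. mseries (g j) y = 0))"
proof -
  define W where "W c s p \<longleftrightarrow> wsummable s c \<and>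
      (\<forall>y\<in>polydisc s. (\<forall>i<p. mseries (g i) y = 0) \<longrightarrow> mseries c y = 0)" for c s p
  define lead where "lead e c \<longleftrightarrow> c e = 1 \<and> (\<forall>m. wt m < wt e \<longrightarrow> c m = 0)"
    for e and c :: "('n \<Rightarrow> nat) \<Rightarrow> real"
  \<comment> \<open>The leading exponents of the ideal. Here s and p may vary with the series;
    common values are needed only for the finitely many series in the basis.\<close>
  define E where "E = {e. \<exists>c s p. W c s p \<and> lead e c}"
  obtain F where F: "F \<subseteq> E" "finite F" "\<And>m. m \<in> E \<Longrightarrow> \<exists>e\<in>F. e \<le> m"
    using dickson[of E] by blast
  have "\<forall>e\<in>F. \<exists>c s p. W c s p \<and> lead e c" using F(1) unfolding E_def by blast
  then obtain C \<sigma> \<pi> where C: "\<And>e. e \<in> F \<Longrightarrow> W (C e) (\<sigma> e) (\<pi> e)" "\<And>e. e \<in> F \<Longrightarrow> lead e (C e)"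
    by metis
  have "\<forall>\<^sub>F s in sequentially. \<forall>e\<in>F. \<sigma> e \<le> s \<and> (\<lambda>m. \<bar>C e m\<bar> * wweight s m) summable_on - {e}
      \<and> (\<Sum>\<^sub>\<infinity>m\<in>-{e}. \<bar>C e m\<bar> * wweight s m) \<le> wweight s e / 2"
  proof (intro eventually_ball_finite F(2) ballI eventually_conj)
    fix e assume e: "e \<in> F"
    have "\<forall>\<^sub>F s in sequentially. (\<lambda>m. \<bar>C e m\<bar> * wweight s m) summable_on - {e}
      \<and> (\<Sum>\<^sub>\<infinity>m\<in>-{e}. \<bar>C e m\<bar> * wweight s m) \<le> wweight s e / 2"
      using C[OF e] unfolding W_def lead_def by (intro leading_coeff_dominates[of "\<sigma> e"]) auto
    then show "\<forall>\<^sub>F s in sequentially. (\<lambda>m. \<bar>C e m\<bar> * wweight s m) summable_on - {e}"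
      "\<forall>\<^sub>F s in sequentially. (\<Sum>\<^sub>\<infinity>m\<in>-{e}. \<bar>C e m\<bar> * wweight s m) \<le> wweight s e / 2"
      by (auto elim: eventually_mono)
  qed (rule eventually_ge_at_top)
  then have "\<forall>\<^sub>F s in sequentially. s0 \<le> s \<and> (\<forall>e\<in>F. \<sigma> e \<le> s \<and> (\<lambda>m. \<bar>C e m\<bar> * wweight s m) summable_on - {e}
      \<and> (\<Sum>\<^sub>\<infinity>m\<in>-{e}. \<bar>C e m\<bar> * wweight s m) \<le> wweight s e / 2)"
    by (intro eventually_conj eventually_ge_at_top)
  then obtain s where s: "s0 \<le> s" "\<And>e. e \<in> F \<Longrightarrow> \<sigma> e \<le> s"
      "\<And>e. e \<in> F \<Longrightarrow> (\<lambda>m. \<bar>C e m\<bar> * wweight s m) summable_on - {e}"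
      "\<And>e. e \<in> F \<Longrightarrow> (\<Sum>\<^sub>\<infinity>m\<in>-{e}. \<bar>C e m\<bar> * wweight s m) \<le> wweight s e / 2"
    unfolding eventually_sequentially by blast
  define p where "p = sum \<pi> F"
  have C0: "mseries (C e) y = 0" if "e \<in> F" "y \<in> polydisc s" "\<And>i. i < p \<Longrightarrow> mseries (g i) y = 0" for e y
  proof -
    have "\<pi> e \<le> p" unfolding p_def using that(1) F(2) by (intro member_le_sum) auto
    then show ?thesis
      using C(1)[OF that(1)] polydisc_antimono[OF s(2)[OF that(1)]] that(2,3) unfolding W_def by force
  qed
  have leadC: "C e e = 1" "wt m < wt e \<Longrightarrow> C e m = 0" if "e \<in> F" for e m
    using C(2)[OF that] unfolding lead_def by auto
  have "mseries (g j) y = 0"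
    if y: "y \<in> polydisc s" and g0: "\<And>i. i < p \<Longrightarrow> mseries (g i) y = 0" for y j
  proof -
    have gj: "wsummable s (g j)" using g s(1) wsummable_mono by blast
    have "\<exists>q. wsummable s q \<and> (\<forall>m. \<forall>e\<in>F. e \<le> m \<longrightarrow> q m = g j m) \<and>
        (\<forall>y\<in>polydisc s. (\<forall>e\<in>F. mseries (C e) y = 0) \<longrightarrow> mseries q y = 0)"
      by (rule standard_basis_division) (fact leadC s(3,4) gj)+
    then obtain q where q: "wsummable s q" "\<forall>m. \<forall>e\<in>F. e \<le> m \<longrightarrow> q m = g j m"
      "\<forall>y\<in>polydisc s. (\<forall>e\<in>F. mseries (C e) y = 0) \<longrightarrow> mseries q y = 0"
      by (elim exE conjE) (rule that)
    have "g j = q"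
    proof (rule ccontr)
      assume "g j \<noteq> q"
      then obtain m0 where "g j m0 \<noteq> q m0" by blast
      \<comment> \<open>The remainder g j - q, scaled to have leading coefficient 1, has leading
        exponent m. It belongs to the ideal, so m is in E and some element of F divides m; but there
        q agrees with g j.\<close>
      then obtain m where m: "g j m \<noteq> q m" "\<And>m'. wt m' < wt m \<Longrightarrow> g j m' = q m'"
        using ex_has_least_nat[of "\<lambda>m. g j m \<noteq> q m" m0 wt] not_le by blast
      define a where "a = inverse (g j m - q m)"
      define c where "c m' = (g j m' - q m') * a" for m'
      have csum: "wsummable s c"
        unfolding wsummable_def
      proof (rule summable_on_comparison_test)
        show "(\<lambda>m. (\<bar>g j m\<bar> * wweight s m + \<bar>q m\<bar> * wweight s m) * \<bar>a\<bar>) summable_on UNIV"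
          using gj q(1) unfolding wsummable_def by (intro summable_on_cmult_left summable_on_add)
        fix m'
        have "\<bar>g j m' - q m'\<bar> * (wweight s m' * \<bar>a\<bar>) \<le> (\<bar>g j m'\<bar> + \<bar>q m'\<bar>) * (wweight s m' * \<bar>a\<bar>)"
          by (intro mult_right_mono) auto
        then show "\<bar>c m'\<bar> * wweight s m' \<le> (\<bar>g j m'\<bar> * wweight s m' + \<bar>q m'\<bar> * wweight s m') * \<bar>a\<bar>"
          unfolding c_def abs_mult by (simp add: algebra_simps)
      qed auto
      \<comment> \<open>The index j itself has to be among the conditions, since the remainder
        involves g j. This is harmless: E puts no bound on p, and the p of the conclusion is not
        changed.\<close>
      have "mseries c z = 0"
        if z: "z \<in> polydisc s" "\<forall>i<max p (Suc j). mseries (g i) z = 0" for z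
      proof -
        have "((\<lambda>m. (g j m * monom_at z m + - (q m * monom_at z m)) * a) has_sum
            (mseries (g j) z + - mseries q z) * a) UNIV"
          unfolding mseries_def
          by (intro has_sum_cmult_left has_sum_add has_sum_uminusI has_sum_infsum
              wsummable_imp_summable(2)[OF _ z(1)] gj q(1))
        then have "mseries c z = (mseries (g j) z - mseries q z) * a"
          unfolding mseries_def[of c] by (intro infsumI) (simp add: c_def algebra_simps)
        moreover have "mseries q z = 0" using q(3) z(1) C0[OF _ z(1)] z(2) by simp
        ultimately show ?thesis using z(2) by simp
      qed
      then have "W c s (max p (Suc j))" unfolding W_def using csum by blast
      moreover have "lead m c" using m by (auto simp: lead_def c_def a_def)
      ultimately have "m \<in> E" unfolding E_def by blast
      with F(3) q(2) m(1) show False by metis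
    qed
    then show ?thesis using q(3) y C0[OF _ y g0] by simp
  qed
  then show ?thesis using s(1) by (intro exI[of _ p] exI[of _ s]) auto
qed

section \<open>Taylor expansion in one coordinate direction\<close>

text \<open>The coefficients of the j-th partial derivative in direction k, divided by j!.\<close>

definition taylor_coeff :: "'n \<Rightarrow> nat \<Rightarrow> (('n \<Rightarrow> nat) \<Rightarrow> real) \<Rightarrow> ('n \<Rightarrow> nat) \<Rightarrow> real" where
  "taylor_coeff k j c m = real ((m k + j) choose j) * c (m(k := m k + j))"

text \<open>The binomial coefficient is at most 2^(m k + j), and 2^(m k) is absorbed by one extra
  step in s because every attached prime is at least 2. The loss is the same for all j, as the
  Noetherian lemma requires a common exponent for the whole family.\<close>

lemma wsummable_taylor_coeff:
  assumes "wsummable s c"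
  shows "wsummable (Suc s) (taylor_coeff k j c)"
proof -
  define e where "e = (\<lambda>i. if i = k then j else 0)"
  have upd: "m(k := m k + j) = m + e" for m by (auto simp: e_def fun_eq_iff)
  have "(\<lambda>m. \<bar>c m\<bar> * wweight s m) summable_on range (\<lambda>m. m + e)"
    using assms unfolding wsummable_def by (rule summable_on_subset) auto
  then have "(\<lambda>m. \<bar>c (m + e)\<bar> * wweight s (m + e)) summable_on UNIV"
    by (subst (asm) summable_on_reindex) (auto simp: inj_on_def fun_eq_iff o_def)
  then have sum: "(\<lambda>m. 2 ^ j / wweight s e * (\<bar>c (m + e)\<bar> * wweight s (m + e))) summable_on UNIV"
    by (rule summable_on_cmult_right)
  show ?thesis
    unfolding wsummable_def
  proof (rule summable_on_comparison_test[OF sum])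
    fix m :: "'a \<Rightarrow> nat"
    have "(2::nat) ^ m k \<le> coord_prime k ^ m k"
      by (intro power_mono coord_prime_ge2) auto
    also have "\<dots> \<le> wt m"
      unfolding wt_def using wt_pos[of m]
      by (intro dvd_imp_le dvd_prodI) (auto simp: wt_def)
    finally have "real (2 ^ m k) \<le> real (wt m)" by (rule of_nat_mono)
    then have 2: "2 ^ m k * wweight 1 m \<le> 1"
      using wt_pos[of m] by (simp add: wweight_def divide_simps)
    have "\<bar>taylor_coeff k j c m\<bar> * wweight (Suc s) m
        = real ((m k + j) choose j) * (\<bar>c (m + e)\<bar> * wweight (1 + s) m)"
      by (simp add: taylor_coeff_def upd abs_mult)
    also have "\<dots> \<le> 2 ^ (m k + j) * (\<bar>c (m + e)\<bar> * wweight (1 + s) m)"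
      using binomial_le_pow2[of "m k + j" j] by (intro mult_right_mono) (auto simp flip: of_nat_le_iff)
    also have "\<dots> = (2 ^ m k * wweight 1 m) * (2 ^ j * (\<bar>c (m + e)\<bar> * wweight s m))"
      unfolding wweight_add_exponent by (simp add: power_add)
    also have "\<dots> \<le> 1 * (2 ^ j * (\<bar>c (m + e)\<bar> * wweight s m))"
      by (intro mult_right_mono 2) auto
    also have "\<dots> = 2 ^ j / wweight s e * (\<bar>c (m + e)\<bar> * wweight s (m + e))"
      using wweight_pos[of s e] by (simp add: wweight_add)
    finally show "\<bar>taylor_coeff k j c m\<bar> * wweight (Suc s) m \<le> \<dots>" .
  qed auto
qed

lemma monom_at_set_coord:
  "monom_at (set_coord k t y) m = t ^ m k * (\<Prod>i\<in>UNIV - {k}. y $ i ^ m i)"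
proof -
  have "monom_at (set_coord k t y) m
      = (set_coord k t y) $ k ^ m k * (\<Prod>i\<in>UNIV - {k}. (set_coord k t y) $ i ^ m i)"
    unfolding monom_at_def by (rule prod.remove) auto
  also have "(\<Prod>i\<in>UNIV - {k}. (set_coord k t y) $ i ^ m i) = (\<Prod>i\<in>UNIV - {k}. y $ i ^ m i)"
    by (intro prod.cong) (auto simp: set_coord_def)
  finally show ?thesis by (simp add: set_coord_def)
qed

lemma set_coord_same [simp]: "set_coord k (y $ k) y = y"
  by (simp add: set_coord_def vec_eq_iff)

lemma monom_at_binomial:
  "monom_at (set_coord k (y $ k + h) y) m
    = (\<Sum>j\<le>m k. real (m k choose j) * (monom_at y (m(k := m k - j)) * h ^ j))"
proof -
  have "monom_at y (m(k := m k - j)) = y $ k ^ (m k - j) * (\<Prod>i\<in>UNIV - {k}. y $ i ^ m i)" for j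
  proof -
    have "monom_at y (m(k := m k - j))
        = y $ k ^ (m k - j) * (\<Prod>i\<in>UNIV - {k}. y $ i ^ (m(k := m k - j)) i)"
      using monom_at_set_coord[of k "y $ k" y "m(k := m k - j)"] by simp
    also have "(\<Prod>i\<in>UNIV - {k}. y $ i ^ (m(k := m k - j)) i) = (\<Prod>i\<in>UNIV - {k}. y $ i ^ m i)"
      by (intro prod.cong) auto
    finally show ?thesis .
  qed
  moreover have "(y $ k + h) ^ m k = (\<Sum>j\<le>m k. real (m k choose j) * h ^ j * y $ k ^ (m k - j))"
    using binomial_ring[of h "y $ k" "m k"] by (simp add: add.commute)
  ultimately show ?thesis
    unfolding monom_at_set_coord by (simp add: sum_distrib_right sum_distrib_left mult_ac)
qed

text \<open>Since the primes are at least 2, \<bar>y $ k\<bar> and \<bar>h\<bar> each take at most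
  half of the larger radius. The point with absolute values serves to majorise the double series in
  the Taylor expansion.\<close>

lemma set_coord_mem_polydisc:
  assumes "y \<in> polydisc (Suc s)" "\<bar>h\<bar> \<le> (1 / real (coord_prime k)) ^ Suc s"
  shows "set_coord k (y $ k + h) y \<in> polydisc s"
    and "set_coord k (\<bar>y $ k\<bar> + \<bar>h\<bar>) (\<chi> i. \<bar>y $ i\<bar>) \<in> polydisc s"
proof -
  have "1 / real (coord_prime k) \<le> 1 / 2"
    using coord_prime_ge2[of k] by (intro divide_left_mono) auto
  then have "2 * (1 / real (coord_prime k)) * (1 / real (coord_prime k)) ^ s
      \<le> 1 * (1 / real (coord_prime k)) ^ s"
    by (intro mult_right_mono) auto
  moreover have "\<bar>y $ k\<bar> \<le> (1 / real (coord_prime k)) ^ Suc s"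
    using assms(1) by (auto simp: polydisc_def)
  ultimately have k: "\<bar>y $ k\<bar> + \<bar>h\<bar> \<le> (1 / real (coord_prime k)) ^ s"
    using assms(2) by simp
  have y: "\<bar>y $ i\<bar> \<le> (1 / real (coord_prime i)) ^ s" for i
    using polydisc_antimono[of s "Suc s"] assms(1) by (auto simp: polydisc_def)
  show "set_coord k (y $ k + h) y \<in> polydisc s"
    "set_coord k (\<bar>y $ k\<bar> + \<bar>h\<bar>) (\<chi> i. \<bar>y $ i\<bar>) \<in> polydisc s"
    using k y abs_triangle_ineq[of "y $ k" h] unfolding polydisc_def set_coord_def
    by (auto intro: order_trans)
qed

text \<open>Expanding each monomial by the binomial theorem gives a double series. It converges
  absolutely, because its absolute values sum to the series of \<bar>c m\<bar> at the point with
  absolute coordinates, so it may be collected by powers of h.\<close>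

lemma mseries_taylor:
  assumes c: "wsummable s c" and y: "y \<in> polydisc (Suc s)"
    and h: "\<bar>h\<bar> \<le> (1 / real (coord_prime k)) ^ Suc s"
  shows "(\<lambda>j. mseries (taylor_coeff k j c) y * h ^ j) sums mseries c (set_coord k (y $ k + h) y)"
proof -
  define G where "G m j = c m * (real (m k choose j) * (monom_at y (m(k := m k - j)) * h ^ j))" for m j
  define Y :: "real^'a" where "Y = (\<chi> i. \<bar>y $ i\<bar>)"
  let ?A = "Sigma (UNIV :: ('a \<Rightarrow> nat) set) (\<lambda>m. {..m k})"
  have absY: "monom_at Y m = \<bar>monom_at y m\<bar>" for m
    by (simp add: monom_at_def Y_def abs_prod power_abs)
  have "(\<lambda>(m, j). \<bar>G m j\<bar>) summable_on ?A"
  proof (rule summable_on_SigmaI)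
    fix m :: "'a \<Rightarrow> nat"
    have "(\<Sum>j\<le>m k. \<bar>G m j\<bar>) = \<bar>c m\<bar> * (\<Sum>j\<le>m k. real (m k choose j) * (monom_at Y (m(k := m k - j)) * \<bar>h\<bar> ^ j))"
      by (simp add: G_def abs_mult absY sum_distrib_left power_abs)
    also have "\<dots> = \<bar>c m\<bar> * monom_at (set_coord k (\<bar>y $ k\<bar> + \<bar>h\<bar>) Y) m"
      using monom_at_binomial[of k Y "\<bar>h\<bar>" m] by (simp add: Y_def)
    also have "\<dots> = \<bar>c m * monom_at (set_coord k (\<bar>y $ k\<bar> + \<bar>h\<bar>) Y) m\<bar>"
      by (simp add: abs_mult monom_at_set_coord abs_prod Y_def power_abs)
    finally show "((\<lambda>j. case (m, j) of (m, j) \<Rightarrow> \<bar>G m j\<bar>) has_sum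
        \<bar>c m * monom_at (set_coord k (\<bar>y $ k\<bar> + \<bar>h\<bar>) Y) m\<bar>) {..m k}"
      by (intro has_sum_finiteI) auto
  next
    show "(\<lambda>m. \<bar>c m * monom_at (set_coord k (\<bar>y $ k\<bar> + \<bar>h\<bar>) Y) m\<bar>) summable_on UNIV"
      using wsummable_imp_summable(1)[OF c set_coord_mem_polydisc(2)[OF y h]] by (simp add: Y_def)
  qed auto
  then have "(\<lambda>(m, j). G m j) summable_on ?A"
    by (subst summable_on_iff_abs_summable_on_real) (simp add: case_prod_unfold)
  then obtain S where S: "((\<lambda>(m, j). G m j) has_sum S) ?A" unfolding summable_on_def by blast
  have "((\<lambda>j. case (m, j) of (m, j) \<Rightarrow> G m j) has_sum c m * monom_at (set_coord k (y $ k + h) y) m) {..m k}"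
    for m
    by (intro has_sum_finiteI) (auto simp: monom_at_binomial G_def sum_distrib_left)
  from has_sum_SigmaD[OF S this] have S_eq: "S = mseries c (set_coord k (y $ k + h) y)"
    unfolding mseries_def by (simp add: infsumI)
  have "((\<lambda>(j, m). taylor_coeff k j c m * monom_at y m * h ^ j) has_sum S) (UNIV \<times> UNIV)"
  \<comment> \<open>The pair (m, j) with j at most m k is renamed to j and the exponent that remains
    after j factors of coordinate k are removed.\<close>
  proof (rule has_sum_reindex_bij_witness[THEN iffD1, OF _ _ _ _ _ _ S])
    show "(\<lambda>(m, j). (j, m(k := m k - j))) a \<in> UNIV \<times> UNIV" for a :: "('a \<Rightarrow> nat) \<times> nat"
      by (cases a) auto
    show "(\<lambda>(j, m). (m(k := m k + j), j)) b \<in> ?A" for b :: "nat \<times> ('a \<Rightarrow> nat)" by (cases b) auto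
    show "(\<lambda>(j, m). (m(k := m k + j), j)) ((\<lambda>(m, j). (j, m(k := m k - j))) a) = a" if "a \<in> ?A" for a
      using that by auto
    show "(\<lambda>(m, j). (j, m(k := m k - j))) ((\<lambda>(j, m). (m(k := m k + j), j)) b) = b"
      for b :: "nat \<times> ('a \<Rightarrow> nat)" by (cases b) auto
    show "(\<lambda>(j, m). taylor_coeff k j c m * monom_at y m * h ^ j) ((\<lambda>(m, j). (j, m(k := m k - j))) a)
        = (\<lambda>(m, j). G m j) a" if "a \<in> ?A" for a
      using that by (cases a) (auto simp: taylor_coeff_def G_def)
  qed simp_all
  then have "((\<lambda>j. mseries (taylor_coeff k j c) y * h ^ j) has_sum S) UNIV"
  proof (rule has_sum_SigmaD)
    fix j
    have "((\<lambda>m. taylor_coeff k j c m * monom_at y m) has_sum mseries (taylor_coeff k j c) y) UNIV"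
      unfolding mseries_def
      by (intro has_sum_infsum wsummable_imp_summable(2)[OF wsummable_taylor_coeff[OF c] y])
    then show "((\<lambda>m. case (j, m) of (j, m) \<Rightarrow> taylor_coeff k j c m * monom_at y m * h ^ j) has_sum
        mseries (taylor_coeff k j c) y * h ^ j) UNIV"
      by (simp add: has_sum_cmult_left)
  qed
  then show ?thesis unfolding S_eq by (rule has_sum_imp_sums)
qed

lemma real_analytic_imp_mseries:
  fixes f :: "real^'n \<Rightarrow> real"
  assumes "real_analytic_on f U" "a \<in> U"
  shows "\<exists>c s. wsummable s c \<and> (\<forall>y\<in>polydisc s. mseries c y = f (a + y))"
proof -
  obtain c \<rho> where \<rho>: "\<rho> > 0" and c: "\<And>x. x \<in> ball a \<rho> \<Longrightarrow>
      ((\<lambda>m. c m * (\<Prod>i\<in>UNIV. (x $ i - a $ i) ^ m i)) has_sum f x) UNIV"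
    using assms unfolding real_analytic_on_def by meson
  have c': "((\<lambda>m. c m * monom_at y m) has_sum f (a + y)) UNIV" if "norm y < \<rho>" for y
    using c[of "a + y"] that by (simp add: monom_at_def dist_norm)
  have "(\<lambda>s. real CARD('n) * (1 / 2) ^ s) \<longlonglongrightarrow> 0"
    by (intro tendsto_mult_right_zero LIMSEQ_power_zero) auto
  then have "\<forall>\<^sub>F s in sequentially. real CARD('n) * (1 / 2) ^ s < \<rho>"
    using \<rho> by (rule order_tendstoD)
  then obtain s where s: "real CARD('n) * (1 / 2) ^ s < \<rho>"
    unfolding eventually_sequentially by blast
  have small: "norm y < \<rho>" if "y \<in> polydisc s" for y :: "real^'n"
  proof -
    have "norm y \<le> (\<Sum>i\<in>UNIV. \<bar>y $ i\<bar>)" by (rule norm_le_l1_cart)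
    also have "\<dots> \<le> (\<Sum>i\<in>(UNIV::'n set). (1 / 2) ^ s)"
    proof (rule sum_mono)
      fix i :: 'n
      have "(1 / real (coord_prime i)) ^ s \<le> (1 / 2) ^ s"
        using coord_prime_ge2[of i] by (intro power_mono divide_left_mono) auto
      then show "\<bar>y $ i\<bar> \<le> (1 / 2) ^ s"
        using that unfolding polydisc_def by (auto intro: order_trans)
    qed
    finally show ?thesis using s by simp
  qed
  \<comment> \<open>The corner of the polydisc. Its monomials are the weights themselves, so
    unordered convergence at this single point is \<open>wsummable s c\<close>.\<close>
  define y0 :: "real^'n" where "y0 = (\<chi> i. (1 / real (coord_prime i)) ^ s)"
  have "monom_at y0 m = wweight s m" for m
  proof -
    have "monom_at y0 m = (\<Prod>i\<in>UNIV. (1 / real (coord_prime i) ^ m i) ^ s)"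
      by (simp add: monom_at_def y0_def power_divide mult.commute flip: power_mult)
    then show ?thesis
      by (simp add: wweight_def wt_def prod_power_distrib[symmetric] prod_dividef)
  qed
  moreover have "(\<lambda>m. c m * monom_at y0 m) summable_on UNIV"
    using c'[OF small[of y0]] by (intro has_sum_imp_summable) (auto simp: y0_def polydisc_def)
  then have "(\<lambda>m. norm (c m * monom_at y0 m)) summable_on UNIV"
    by (subst (asm) summable_on_iff_abs_summable_on_real)
  ultimately have "wsummable s c" by (simp add: wsummable_def abs_mult)
  moreover have "mseries c y = f (a + y)" if "y \<in> polydisc s" for y
    unfolding mseries_def using c' small[OF that] by (auto intro: infsumI)
  ultimately show ?thesis by blast
qed

lemma open_ball_subset_polydisc: "\<exists>\<epsilon>>0. ball (0::real^'n) \<epsilon> \<subseteq> polydisc s"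
proof -
  define \<epsilon> where "\<epsilon> = Min (range (\<lambda>i::'n. (1 / real (coord_prime i)) ^ s))"
  have "\<epsilon> > 0"
    unfolding \<epsilon>_def by (subst Min_gr_iff) (auto simp: prime_gt_0_nat coord_prime(2))
  moreover have "y \<in> polydisc s" if "norm y < \<epsilon>" for y :: "real^'n"
    unfolding polydisc_def
  proof clarify
    fix i :: 'n
    have "\<bar>y $ i\<bar> \<le> norm y" by (rule component_le_norm_cart)
    also have "\<dots> \<le> \<epsilon>" using that by simp
    also have "\<dots> \<le> (1 / real (coord_prime i)) ^ s" unfolding \<epsilon>_def by (intro Min_le) auto
    finally show "\<bar>y $ i\<bar> \<le> (1 / real (coord_prime i)) ^ s" .
  qed
  ultimately show ?thesis by auto
qed

text \<open>For x near a, the coefficients b j are the values at x - a of fixed power series, so the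
  vanishing of the first p of them is a condition on common zeros. The shift by \<open>Suc\<close>
  leaves out order 0, the value of f. Only p and \<epsilon> are uniform; b and \<delta> come after
  x.\<close>

lemma local_uniform_order:
  fixes f :: "real^'n \<Rightarrow> real"
  assumes "real_analytic_on f U" "a \<in> U"
  shows "\<exists>p. \<exists>\<epsilon>>0. \<forall>x\<in>ball a \<epsilon>. \<exists>b. \<exists>\<delta>>0.
    (\<forall>h. \<bar>h\<bar> < \<delta> \<longrightarrow> (\<lambda>j. b j * h ^ j) sums f (set_coord k (x $ k + h) x)) \<and>
    ((\<forall>j\<in>{1..p}. b j = 0) \<longrightarrow> (\<forall>j\<ge>1. b j = 0))"
proof -
  obtain c s where c: "wsummable s c" and f: "\<forall>y\<in>polydisc s. mseries c y = f (a + y)"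
    using real_analytic_imp_mseries[OF assms] by (elim exE conjE) (rule that)
  have "\<exists>p s'. Suc s \<le> s' \<and> (\<forall>y\<in>polydisc s'. (\<forall>i<p. mseries (taylor_coeff k (Suc i) c) y = 0) \<longrightarrow>
      (\<forall>j. mseries (taylor_coeff k (Suc j) c) y = 0))"
    by (rule common_zeros_finitely_determined) (rule wsummable_taylor_coeff[OF c])
  then obtain p s' where s': "Suc s \<le> s'" and p: "\<forall>y\<in>polydisc s'.
      (\<forall>i<p. mseries (taylor_coeff k (Suc i) c) y = 0) \<longrightarrow> (\<forall>j. mseries (taylor_coeff k (Suc j) c) y = 0)"
    by (elim exE conjE) (rule that)
  obtain \<epsilon> where \<epsilon>: "\<epsilon> > 0" "ball 0 \<epsilon> \<subseteq> (polydisc s' :: (real^'n) set)"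
    using open_ball_subset_polydisc by blast
  show ?thesis
  proof (intro exI[of _ p] exI[of _ \<epsilon>] conjI ballI \<epsilon>(1))
    fix x assume x: "x \<in> ball a \<epsilon>"
    define y where "y = x - a"
    define b where "b j = mseries (taylor_coeff k j c) y" for j
    define \<delta> where "\<delta> = (1 / real (coord_prime k)) ^ Suc s"
    have "y \<in> ball 0 \<epsilon>" using x by (simp add: y_def dist_norm norm_minus_commute)
    then have y': "y \<in> polydisc s'" using \<epsilon> by blast
    then have y: "y \<in> polydisc (Suc s)" using polydisc_antimono[OF s'] by blast
    have "(\<lambda>j. b j * h ^ j) sums f (set_coord k (x $ k + h) x)" if "\<bar>h\<bar> < \<delta>" for h
    proof -
      have h: "\<bar>h\<bar> \<le> (1 / real (coord_prime k)) ^ Suc s" using that by (simp add: \<delta>_def)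
      have "a + set_coord k (y $ k + h) y = set_coord k (x $ k + h) x"
        by (simp add: vec_eq_iff set_coord_def y_def)
      then show ?thesis
        using mseries_taylor[OF c y h] f set_coord_mem_polydisc(1)[OF y h] by (simp add: b_def)
    qed
    moreover have "b j = 0" if "\<forall>j\<in>{1..p}. b j = 0" "j \<ge> 1" for j
    proof -
      have "\<forall>i<p. mseries (taylor_coeff k (Suc i) c) y = 0" using that(1) by (auto simp: b_def)
      then have "mseries (taylor_coeff k (Suc (j - 1)) c) y = 0" using p y' by blast
      then show ?thesis using that(2) by (simp add: b_def)
    qed
    moreover have "\<delta> > 0" by (simp add: \<delta>_def prime_gt_0_nat coord_prime(2))
    ultimately show "\<exists>b. \<exists>\<delta>>0. (\<forall>h. \<bar>h\<bar> < \<delta> \<longrightarrow> (\<lambda>j. b j * h ^ j) sums f (set_coord k (x $ k + h) x)) \<and>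
      ((\<forall>j\<in>{1..p}. b j = 0) \<longrightarrow> (\<forall>j\<ge>1. b j = 0))" by blast
  qed
qed

section \<open>Oscillatory integrals in one variable\<close>

lemma power_series_DERIV:
  fixes v :: "nat \<Rightarrow> real"
  assumes "\<And>h. \<bar>h\<bar> < \<delta> \<Longrightarrow> summable (\<lambda>n. v n * h ^ n)" "\<bar>h\<bar> < \<delta>"
  shows "((\<lambda>h. \<Sum>n. v n * h ^ n) has_real_derivative (\<Sum>n. diffs v n * h ^ n)) (at h)"
    and "summable (\<lambda>n. diffs v n * h ^ n)"
proof -
  define K where "K = (\<bar>h\<bar> + \<delta>) / 2"
  have K: "\<bar>h\<bar> < K" "K < \<delta>" using assms(2) by (auto simp: K_def)
  then have "summable (\<lambda>n. v n * K ^ n)" using assms(1)[of K] by simp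
  then show "((\<lambda>h. \<Sum>n. v n * h ^ n) has_real_derivative (\<Sum>n. diffs v n * h ^ n)) (at h)"
    by (rule termdiffs_strong) (use K in auto)
  show "summable (\<lambda>n. diffs v n * h ^ n)"
    by (rule termdiff_converges[where K = \<delta>]) (use assms in auto)
qed

text \<open>Write \<phi> h = b 0 + h^j * V h with V 0 = b j. Then the derivative is h^(j - 1) * (j *
  V h + h * V' h), and the second factor has the nonzero value j * b j at 0, hence no zero
  nearby.\<close>

lemma derivative_factorization:
  fixes \<phi> :: "real \<Rightarrow> real"
  assumes sums: "\<And>h. \<bar>h\<bar> < \<delta> \<Longrightarrow> (\<lambda>m. b m * h ^ m) sums \<phi> h" and \<delta>: "\<delta> > 0"
    and j: "j \<ge> 1" "b j \<noteq> 0" "\<And>m. 1 \<le> m \<Longrightarrow> m < j \<Longrightarrow> b m = 0"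
  obtains \<epsilon> U U1 where "0 < \<epsilon>" "\<epsilon> < \<delta>"
    "\<And>h. \<bar>h\<bar> \<le> \<epsilon> \<Longrightarrow> (\<phi> has_real_derivative h ^ (j - 1) * U h) (at h)"
    "\<And>h. \<bar>h\<bar> \<le> \<epsilon> \<Longrightarrow> (U has_real_derivative U1 h) (at h)"
    "\<And>h. \<bar>h\<bar> \<le> \<epsilon> \<Longrightarrow> U h \<noteq> 0" "continuous_on {-\<epsilon>..\<epsilon>} U1"
proof -
  define v where "v m = b (m + j)" for m
  have split: "(\<lambda>m. v m * h ^ m) sums ((\<phi> h - b 0) / h ^ j)" if "\<bar>h\<bar> < \<delta>" "h \<noteq> 0" for h
  proof -
    have "(\<lambda>m. b (m + j) * h ^ (m + j)) sums (\<phi> h - (\<Sum>m<j. b m * h ^ m))"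
      using sums_split_initial_segment[OF sums[OF that(1)]] by blast
    moreover have "(\<Sum>m<j. b m * h ^ m) = (\<Sum>m<j. if m = 0 then b 0 else 0)"
      using j(3) by (intro sum.cong) auto
    ultimately have "(\<lambda>m. b (m + j) * h ^ (m + j)) sums (\<phi> h - b 0)"
      using j(1) by (simp add: sum.delta)
    from sums_divide[OF this, of "h ^ j"] show ?thesis
      using that(2) by (simp add: v_def power_add)
  qed
  have v: "summable (\<lambda>m. v m * h ^ m)" if "\<bar>h\<bar> < \<delta>" for h
  proof (cases "h = 0")
    case True
    then show ?thesis using summable_0_powser[of v] by simp
  qed (use split that sums_summable in blast)
  define V where "V h = (\<Sum>m. v m * h ^ m)" for h
  define V1 where "V1 h = (\<Sum>m. diffs v m * h ^ m)" for h
  define V2 where "V2 h = (\<Sum>m. diffs (diffs v) m * h ^ m)" for h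
  \<comment> \<open>Differentiating once more gives continuity of V2, and with it that of
    U1.\<close>
  define V3 where "V3 h = (\<Sum>m. diffs (diffs (diffs v)) m * h ^ m)" for h
  have dv: "summable (\<lambda>m. diffs v m * h ^ m)" if "\<bar>h\<bar> < \<delta>" for h
    using power_series_DERIV(2)[OF v that] .
  have ddv: "summable (\<lambda>m. diffs (diffs v) m * h ^ m)" if "\<bar>h\<bar> < \<delta>" for h
    using power_series_DERIV(2)[OF dv that] .
  have DV: "(V has_real_derivative V1 h) (at h)" if "\<bar>h\<bar> < \<delta>" for h
    using power_series_DERIV(1)[OF v that] unfolding V_def V1_def .
  have DV1: "(V1 has_real_derivative V2 h) (at h)" if "\<bar>h\<bar> < \<delta>" for h
    using power_series_DERIV(1)[OF dv that] unfolding V1_def V2_def .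
  have DV2: "(V2 has_real_derivative V3 h) (at h)" if "\<bar>h\<bar> < \<delta>" for h
    using power_series_DERIV(1)[OF ddv that] unfolding V2_def V3_def .
  have \<phi>: "\<phi> h = b 0 + h ^ j * V h" if "\<bar>h\<bar> < \<delta>" for h
  proof (cases "h = 0")
    case True
    have "(\<lambda>m. b m * 0 ^ m) sums b 0" using powser_sums_zero[of b] by simp
    then show ?thesis using sums[of 0] \<delta> j(1) True sums_unique2 by (auto simp: power_0_left)
  next
    case False
    then show ?thesis using split[OF that False] by (simp add: V_def sums_iff)
  qed
  define U where "U h = real j * V h + h * V1 h" for h
  define U1 where "U1 h = real j * V1 h + (V1 h + h * V2 h)" for h
  have D\<phi>: "(\<phi> has_real_derivative h ^ (j - 1) * U h) (at h)" if h: "\<bar>h\<bar> < \<delta>" for h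
  proof -
    obtain i where i: "j = Suc i" using j(1) by (cases j) auto
    have "((\<lambda>h. b 0 + h ^ j * V h) has_real_derivative h ^ (j - 1) * U h) (at h)"
      unfolding i by (rule derivative_eq_intros DV[OF h] refl)+ (simp add: U_def i algebra_simps)
    then show ?thesis
    proof (rule has_field_derivative_transform_within_open)
      show "open {-\<delta><..<\<delta>}" by simp
    qed (use h \<phi> in auto)
  qed
  have DU: "(U has_real_derivative U1 h) (at h)" if h: "\<bar>h\<bar> < \<delta>" for h
    unfolding U_def[abs_def] U1_def
    by (auto intro!: derivative_eq_intros DV[OF h] DV1[OF h] simp: algebra_simps)
  have "U 0 = real j * b j"
    using powser_sums_zero[of v] by (simp add: U_def V_def v_def sums_iff)
  then have "U 0 \<noteq> 0" using j by simp
  moreover have "isCont U 0" using DU[of 0] \<delta> by (auto intro: DERIV_isCont)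
  ultimately obtain e where e: "e > 0" "\<And>h. \<bar>h\<bar> < e \<Longrightarrow> U h \<noteq> 0"
    using continuous_at_avoid[of 0 U 0] by (auto simp: dist_real_def)
  define \<epsilon> where "\<epsilon> = min e \<delta> / 2"
  have \<epsilon>: "0 < \<epsilon>" "\<epsilon> < \<delta>" "\<epsilon> < e" using e(1) \<delta> by (auto simp: \<epsilon>_def min_def)
  have "continuous_on {-\<epsilon>..\<epsilon>} U1"
  proof (rule continuous_at_imp_continuous_on, rule ballI)
    fix h assume "h \<in> {-\<epsilon>..\<epsilon>}"
    then have "\<bar>h\<bar> < \<delta>" using \<epsilon> by auto
    then show "isCont U1 h"
      unfolding U1_def[abs_def] using DERIV_isCont[OF DV1] DERIV_isCont[OF DV2]
      by (intro continuous_intros) auto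
  qed
  with \<epsilon> D\<phi> DU e(2) show ?thesis by (intro that[of \<epsilon> U U1]) auto
qed

text \<open>A van der Corput estimate at an endpoint where the derivative vanishes to order j - 1.
  The constant depends on bounds for 1 / U and its derivative, and neither on the subinterval nor on
  lam.\<close>

lemma oscillatory_integral_right:
  fixes \<phi> :: "real \<Rightarrow> real"
  assumes \<epsilon>: "\<epsilon> > 0" and j: "j \<ge> 1"
    and D\<phi>: "\<And>h. h \<in> {0..\<epsilon>} \<Longrightarrow> (\<phi> has_real_derivative h ^ (j - 1) * U h) (at h)"
    and DU: "\<And>h. h \<in> {0..\<epsilon>} \<Longrightarrow> (U has_real_derivative U1 h) (at h)"
    and U: "\<And>h. h \<in> {0..\<epsilon>} \<Longrightarrow> U h \<noteq> 0" and U1: "continuous_on {0..\<epsilon>} U1"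
  shows "\<exists>C\<ge>0. \<forall>lam a c. lam \<noteq> 0 \<longrightarrow> 0 \<le> a \<longrightarrow> a \<le> c \<longrightarrow> c \<le> \<epsilon> \<longrightarrow>
    norm (integral {a..c} (\<lambda>h. exp (\<i> * complex_of_real (lam * \<phi> h)))) \<le> C * \<bar>lam\<bar> powr (- 1 / real j)"
proof -
  obtain i where i: "j = Suc i" using j by (cases j) auto
  have Dinv: "((\<lambda>h. 1 / h ^ i) has_real_derivative - (real i / h ^ Suc i)) (at h within S)"
    if "h > 0" for h :: real and S
  proof -
    have "- (inverse (h ^ i) * (real i * h ^ (i - Suc 0)) * inverse (h ^ i)) = - (real i / h ^ Suc i)"
      using that by (cases i) (simp_all add: field_simps)
    then show ?thesis
      using DERIV_inverse'[OF DERIV_pow[of i h S]] that by (simp add: inverse_eq_divide)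
  qed
  define W where "W h = 1 / U h" for h
  define W1 where "W1 h = - U1 h / (U h)\<^sup>2" for h
  have DW: "(W has_real_derivative W1 h) (at h)" if h: "h \<in> {0..\<epsilon>}" for h
    unfolding W_def[abs_def] W1_def
    by (auto intro!: derivative_eq_intros DU[OF h] simp: U[OF h] power2_eq_square)
  have contU: "continuous_on {0..\<epsilon>} U"
    by (rule continuous_at_imp_continuous_on) (use DERIV_isCont[OF DU] in blast)
  have contW: "continuous_on {0..\<epsilon>} W" "continuous_on {0..\<epsilon>} W1"
    unfolding W_def[abs_def] W1_def[abs_def] using U by (auto intro!: continuous_intros contU U1)
  have "bounded (W ` {0..\<epsilon>})" "bounded (W1 ` {0..\<epsilon>})"
    by (intro compact_imp_bounded compact_continuous_image contW compact_Icc)+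
  then obtain K K1 where "\<forall>h\<in>{0..\<epsilon>}. \<bar>W h\<bar> \<le> K" "\<forall>h\<in>{0..\<epsilon>}. \<bar>W1 h\<bar> \<le> K1"
    unfolding bounded_iff by auto
  then have K: "\<bar>W h\<bar> \<le> K" and K1: "\<bar>W1 h\<bar> \<le> K1" if "h \<in> {0..\<epsilon>}" for h
    using that by blast+
  have K0: "K \<ge> 0" "K1 \<ge> 0" using K[of 0] K1[of 0] \<epsilon> by auto
  \<comment> \<open>Two boundary terms and the integral of (j - 1) / h^j contribute K each; the
    derivative of 1 / U contributes K1 times the length.\<close>
  define M where "M = 3 * K + K1 * \<epsilon>"
  have M0: "M \<ge> 0" using K0 \<epsilon> by (simp add: M_def)
  define e where "e lam h = exp (\<i> * complex_of_real (lam * \<phi> h))" for lam h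
  have norm_e: "norm (e lam h) = 1" for lam h by (simp add: e_def norm_exp_i_times)
  have De: "(e lam has_vector_derivative (\<i> * complex_of_real (lam * (h ^ (j - 1) * U h)) * e lam h)) (at h within S)"
    if h: "h \<in> {0..\<epsilon>}" for lam h S
  proof -
    have 1: "((\<lambda>h. \<i> * complex_of_real (lam * \<phi> h)) has_vector_derivative
        \<i> * complex_of_real (lam * (h ^ (j - 1) * U h))) (at h)"
      using D\<phi>[OF h]
      by (auto intro!: derivative_eq_intros simp: has_real_derivative_iff_has_vector_derivative)
    have "(e lam has_vector_derivative (\<i> * complex_of_real (lam * (h ^ (j - 1) * U h)) * e lam h)) (at h)"
      using field_vector_diff_chain_at[OF 1 DERIV_exp] unfolding e_def o_def .
    then show ?thesis by (rule has_vector_derivative_at_within)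
  qed
  have e_cont: "continuous_on S (e lam)" if "S \<subseteq> {0..\<epsilon>}" for S lam
    using De that by (intro continuous_on_vector_derivative) blast
  have away: "\<bar>lam\<bar> * norm (integral {a..c} (e lam)) \<le> M / a ^ (j - 1)"
    if ac: "0 < a" "a \<le> c" "c \<le> \<epsilon>" for lam a c
  proof -
    have sub: "{a..c} \<subseteq> {0..\<epsilon>}" using ac by auto
    \<comment> \<open>G is the reciprocal of the derivative of \<phi>, so differentiating e * G
      gives \<i> * lam * e plus an error with G1.\<close>
    define G where "G h = W h / h ^ (j - 1)" for h
    define G1 where "G1 h = W1 h / h ^ (j - 1) - real (j - 1) * W h / h ^ j" for h
    have DG: "(G has_real_derivative G1 h) (at h)" if h: "h \<in> {a..c}" for h
    proof -
      have "h > 0" "h \<in> {0..\<epsilon>}" using h ac by auto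
      then show ?thesis
        using DERIV_mult[OF DW Dinv, of h]
        unfolding G_def[abs_def] G1_def i by (simp add: field_simps)
    qed
    have "((\<lambda>h. e lam h * complex_of_real (G h)) has_vector_derivative
        (\<i> * complex_of_real lam * e lam h + e lam h * complex_of_real (G1 h))) (at h within {a..c})"
      if h: "h \<in> {a..c}" for h
    proof -
      have hh: "h \<in> {0..\<epsilon>}" "h > 0" using h ac by auto
      have GU: "h ^ (j - 1) * U h * G h = 1" using U[OF hh(1)] hh(2) by (simp add: G_def W_def)
      have "((\<lambda>h. complex_of_real (G h)) has_vector_derivative complex_of_real (G1 h)) (at h within {a..c})"
        using DG[OF h]
        by (intro has_vector_derivative_of_real has_vector_derivative_at_within)
          (simp add: has_real_derivative_iff_has_vector_derivative)
      from has_vector_derivative_mult[OF De[OF hh(1)] this]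
      have "((\<lambda>h. e lam h * complex_of_real (G h)) has_vector_derivative
          (e lam h * complex_of_real (G1 h)
            + \<i> * complex_of_real (lam * (h ^ (j - 1) * U h)) * e lam h * complex_of_real (G h))) (at h within {a..c})" .
      moreover have "\<i> * complex_of_real (lam * (h ^ (j - 1) * U h)) * e lam h * complex_of_real (G h)
          = \<i> * complex_of_real (lam * (h ^ (j - 1) * U h * G h)) * e lam h"
        by simp
      then have "\<i> * complex_of_real (lam * (h ^ (j - 1) * U h)) * e lam h * complex_of_real (G h)
          = \<i> * complex_of_real lam * e lam h"
        unfolding GU by simp
      ultimately show ?thesis by (simp only: add.commute)
    qed
    then have FTC: "((\<lambda>h. \<i> * complex_of_real lam * e lam h + e lam h * complex_of_real (G1 h)) has_integral
        (e lam c * complex_of_real (G c) - e lam a * complex_of_real (G a))) {a..c}"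
      by (intro fundamental_theorem_of_calculus ac(2))
    have "(e lam has_integral integral {a..c} (e lam)) {a..c}"
      by (intro integrable_integral integrable_continuous_interval e_cont sub)
    from has_integral_diff[OF FTC has_integral_mult_right[OF this, of "\<i> * complex_of_real lam"]]
    have rest: "((\<lambda>h. e lam h * complex_of_real (G1 h)) has_integral
        (e lam c * complex_of_real (G c) - e lam a * complex_of_real (G a)
          - \<i> * complex_of_real lam * integral {a..c} (e lam))) {a..c}"
      by simp
    \<comment> \<open>This majorant has an explicit antiderivative: (j - 1) / h^j integrates to at
      most 1 / a^(j - 1) whatever the length, whereas its maximum alone would cost a further factor
      1 / a.\<close>
    have maj: "((\<lambda>h. K1 / a ^ (j - 1) + K * (real (j - 1) / h ^ j)) has_integral
        ((K1 / a ^ (j - 1) * c - K * (1 / c ^ (j - 1))) - (K1 / a ^ (j - 1) * a - K * (1 / a ^ (j - 1))))) {a..c}"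
    proof (rule fundamental_theorem_of_calculus[OF ac(2)])
      fix h assume h: "h \<in> {a..c}"
      have "((\<lambda>h. K1 / a ^ (j - 1) * h - K * (1 / h ^ (j - 1))) has_real_derivative
          K1 / a ^ (j - 1) + K * (real (j - 1) / h ^ j)) (at h within {a..c})"
        using DERIV_diff[OF DERIV_cmult_Id[of "K1 / a ^ i" h] DERIV_cmult[OF Dinv, of h K], of "{a..c}"] h ac
        unfolding i by simp
      then show "((\<lambda>h. K1 / a ^ (j - 1) * h - K * (1 / h ^ (j - 1))) has_vector_derivative
          K1 / a ^ (j - 1) + K * (real (j - 1) / h ^ j)) (at h within {a..c})"
        by (simp add: has_real_derivative_iff_has_vector_derivative)
    qed
    have pointwise: "norm (e lam h * complex_of_real (G1 h)) \<le> K1 / a ^ (j - 1) + K * (real (j - 1) / h ^ j)"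
      if h: "h \<in> {a..c}" for h
    proof -
      from h have hh: "h \<in> {0..\<epsilon>}" "h > 0" "a ^ (j - 1) \<le> h ^ (j - 1)" "0 < a ^ (j - 1)"
        using ac by (auto intro: power_mono)
      have "\<bar>W1 h\<bar> / h ^ (j - 1) \<le> K1 / a ^ (j - 1)"
        using K1[OF hh(1)] hh K0 by (intro frac_le) auto
      moreover have "\<bar>W h\<bar> * (real (j - 1) / h ^ j) \<le> K * (real (j - 1) / h ^ j)"
        using K[OF hh(1)] hh by (intro mult_right_mono) auto
      moreover have "\<bar>G1 h\<bar> \<le> \<bar>W1 h / h ^ (j - 1)\<bar> + \<bar>real (j - 1) * W h / h ^ j\<bar>"
        unfolding G1_def by (rule abs_triangle_ineq4)
      then have "\<bar>G1 h\<bar> \<le> \<bar>W1 h\<bar> / h ^ (j - 1) + \<bar>W h\<bar> * (real (j - 1) / h ^ j)"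
        using hh(2) by (simp add: abs_mult mult.commute)
      ultimately show ?thesis
        by (simp add: norm_mult norm_e)
    qed
    have "norm (e lam c * complex_of_real (G c) - e lam a * complex_of_real (G a)
          - \<i> * complex_of_real lam * integral {a..c} (e lam))
        \<le> (K1 / a ^ (j - 1) * c - K * (1 / c ^ (j - 1))) - (K1 / a ^ (j - 1) * a - K * (1 / a ^ (j - 1)))"
      using integral_norm_bound_integral[OF has_integral_integrable[OF rest] has_integral_integrable[OF maj] pointwise]
      unfolding integral_unique[OF rest] integral_unique[OF maj] .
    moreover have "norm (\<i> * complex_of_real lam * integral {a..c} (e lam))
        \<le> norm (e lam c * complex_of_real (G c) - e lam a * complex_of_real (G a)
          - \<i> * complex_of_real lam * integral {a..c} (e lam))
          + (norm (e lam c * complex_of_real (G c)) + norm (e lam a * complex_of_real (G a)))"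
      by (smt (verit) norm_minus_commute norm_triangle_ineq4 norm_triangle_sub)
    moreover have "norm (e lam h * complex_of_real (G h)) \<le> K / a ^ (j - 1)" if "h \<in> {a..c}" for h
    proof -
      have "\<bar>W h\<bar> / h ^ (j - 1) \<le> K / a ^ (j - 1)"
        using K[of h] that ac K0 by (intro frac_le power_mono) auto
      then show ?thesis
        unfolding norm_mult norm_e norm_of_real G_def abs_divide using that ac by simp
    qed
    then have "norm (e lam c * complex_of_real (G c)) \<le> K / a ^ (j - 1)"
      "norm (e lam a * complex_of_real (G a)) \<le> K / a ^ (j - 1)" using ac by auto
    moreover have "(K1 / a ^ (j - 1) * c - K * (1 / c ^ (j - 1))) - (K1 / a ^ (j - 1) * a - K * (1 / a ^ (j - 1)))
        \<le> K1 * \<epsilon> / a ^ (j - 1) + K / a ^ (j - 1)"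
    proof -
      have "K1 / a ^ (j - 1) * (c - a) \<le> K1 / a ^ (j - 1) * \<epsilon>"
        using ac K0 by (intro mult_left_mono) auto
      moreover have "0 \<le> K * (1 / c ^ (j - 1))" using ac K0 by simp
      moreover have "K1 / a ^ (j - 1) * (c - a) = K1 / a ^ (j - 1) * c - K1 / a ^ (j - 1) * a"
        by (rule right_diff_distrib)
      moreover have "K1 / a ^ (j - 1) * \<epsilon> = K1 * \<epsilon> / a ^ (j - 1)" "K * (1 / a ^ (j - 1)) = K / a ^ (j - 1)"
        by simp_all
      ultimately show ?thesis by linarith
    qed
    ultimately have "norm (\<i> * complex_of_real lam * integral {a..c} (e lam))
        \<le> K1 * \<epsilon> / a ^ (j - 1) + K / a ^ (j - 1) + (K / a ^ (j - 1) + K / a ^ (j - 1))"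
      by linarith
    also have "\<dots> = M / a ^ (j - 1)" by (simp add: M_def add_divide_distrib[symmetric])
    finally show ?thesis by (simp add: norm_mult)
  qed
  show ?thesis
  proof (intro exI[of _ "1 + M"] conjI allI impI)
    show "0 \<le> 1 + M" using M0 by simp
    fix lam a c :: real
    assume lam: "lam \<noteq> 0" and ac: "0 \<le> a" "a \<le> c" "c \<le> \<epsilon>"
    define \<alpha> where "\<alpha> = \<bar>lam\<bar> powr (- 1 / real j)"
    have \<alpha>: "\<alpha> > 0" using lam by (simp add: \<alpha>_def)
    have "\<alpha> ^ j = \<bar>lam\<bar> powr (-1)"
      using j lam by (simp add: \<alpha>_def powr_realpow[symmetric] powr_powr)
    \<comment> \<open>By this identity the bound M / (\<bar>lam\<bar> * \<alpha>^(j - 1)) beyond the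
      cut equals M * \<alpha>, of the same size as the length of the part before it.\<close>
    then have \<alpha>j: "\<bar>lam\<bar> * \<alpha> ^ j = 1" using lam by (simp add: powr_minus)
    have short: "norm (integral {a..c} (e lam)) \<le> c - a" if "0 \<le> a" "a \<le> c" "c \<le> \<epsilon>" for a c
      using integral_bound[of a c "e lam" 1] that e_cont[of "{a..c}" lam] by (auto simp: norm_e)
    have long: "norm (integral {a..c} (e lam)) \<le> M * \<alpha>" if "\<alpha> \<le> a" "a \<le> c" "c \<le> \<epsilon>" for a c
    proof -
      have "\<bar>lam\<bar> * norm (integral {a..c} (e lam)) \<le> M / a ^ (j - 1)"
        using that \<alpha> by (intro away) auto
      also have "\<dots> \<le> M / \<alpha> ^ (j - 1)"
        using that \<alpha> M0 by (intro divide_left_mono power_mono mult_pos_pos zero_less_power) auto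
      also have "\<dots> = \<bar>lam\<bar> * (M * \<alpha>)"
        using \<alpha>j \<alpha> by (simp add: i field_simps)
      finally show ?thesis using lam by simp
    qed
    have "norm (integral {a..c} (e lam)) \<le> (1 + M) * \<alpha>"
    proof (cases "c \<le> \<alpha>")
      case True
      have "(1 + M) * \<alpha> = \<alpha> + M * \<alpha>" "0 \<le> M * \<alpha>" using M0 \<alpha> by (simp_all add: distrib_right)
      then show ?thesis using short[OF ac] ac True by linarith
    next
      case False
      show ?thesis
      proof (cases "\<alpha> \<le> a")
        case True
        then show ?thesis using long[OF True ac(2,3)] \<alpha> by (simp add: distrib_right)
      next
        case False
        have "integral {a..\<alpha>} (e lam) + integral {\<alpha>..c} (e lam) = integral {a..c} (e lam)"
          using False \<open>\<not> c \<le> \<alpha>\<close> ac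
          by (intro Henstock_Kurzweil_Integration.integral_combine integrable_continuous_interval e_cont) auto
        then have "norm (integral {a..c} (e lam))
            \<le> norm (integral {a..\<alpha>} (e lam)) + norm (integral {\<alpha>..c} (e lam))"
          using norm_triangle_ineq by metis
        also have "\<dots> \<le> (\<alpha> - a) + M * \<alpha>"
          using False \<open>\<not> c \<le> \<alpha>\<close> ac by (intro add_mono short long) auto
        finally show ?thesis using ac by (simp add: distrib_right)
      qed
    qed
    then show "norm (integral {a..c} (\<lambda>h. exp (\<i> * complex_of_real (lam * \<phi> h))))
        \<le> (1 + M) * \<bar>lam\<bar> powr (- 1 / real j)"
      by (simp add: e_def[abs_def] \<alpha>_def)
  qed
qed

text \<open>The left half is the right half of the reflected phase. The nonzero derivative off t0 is
  recorded because it excludes local constancy at the neighbouring points, which the dichotomy along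
  the segment needs.\<close>

lemma oscillatory_integral_local:
  fixes \<phi> :: "real \<Rightarrow> real"
  assumes sums: "\<And>h. \<bar>h\<bar> < \<delta> \<Longrightarrow> (\<lambda>m. b m * h ^ m) sums \<phi> (t0 + h)" and \<delta>: "\<delta> > 0"
    and j: "j \<ge> 1" "j \<le> p" "b j \<noteq> 0" "\<And>m. 1 \<le> m \<Longrightarrow> m < j \<Longrightarrow> b m = 0"
  shows "\<exists>\<epsilon>>0. continuous_on {t0 - \<epsilon>..t0 + \<epsilon>} \<phi> \<and>
    (\<forall>t. t \<noteq> t0 \<longrightarrow> \<bar>t - t0\<bar> \<le> \<epsilon> \<longrightarrow> (\<exists>D. D \<noteq> 0 \<and> (\<phi> has_real_derivative D) (at t))) \<and>
    (\<exists>C\<ge>0. \<forall>lam a c. lam \<noteq> 0 \<longrightarrow> t0 - \<epsilon> \<le> a \<longrightarrow> a \<le> c \<longrightarrow> c \<le> t0 + \<epsilon> \<longrightarrow>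
      norm (integral {a..c} (\<lambda>t. exp (\<i> * complex_of_real (lam * \<phi> t)))) \<le> C * \<bar>lam\<bar> powr (- 1 / real p))"
proof -
  obtain \<epsilon> U U1 where \<epsilon>: "0 < \<epsilon>" "\<epsilon> < \<delta>"
    and D: "\<And>h. \<bar>h\<bar> \<le> \<epsilon> \<Longrightarrow> ((\<lambda>h. \<phi> (t0 + h)) has_real_derivative h ^ (j - 1) * U h) (at h)"
    and DU: "\<And>h. \<bar>h\<bar> \<le> \<epsilon> \<Longrightarrow> (U has_real_derivative U1 h) (at h)"
    and U: "\<And>h. \<bar>h\<bar> \<le> \<epsilon> \<Longrightarrow> U h \<noteq> 0" and U1: "continuous_on {-\<epsilon>..\<epsilon>} U1"
    using derivative_factorization[of \<delta> b "\<lambda>h. \<phi> (t0 + h)" j, OF sums \<delta> j(1,3,4)] by metis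
  have D\<phi>: "(\<phi> has_real_derivative (t - t0) ^ (j - 1) * U (t - t0)) (at t)" if "\<bar>t - t0\<bar> \<le> \<epsilon>" for t
    using D[OF that] DERIV_at_within_shift[of \<phi> _ "t0" "t - t0" UNIV] by (simp add: add.commute)
  have cont: "continuous_on {t0 - \<epsilon>..t0 + \<epsilon>} \<phi>"
    by (rule continuous_at_imp_continuous_on) (auto intro!: DERIV_isCont[OF D\<phi>])
  have deriv: "\<exists>D. D \<noteq> 0 \<and> (\<phi> has_real_derivative D) (at t)" if "t \<noteq> t0" "\<bar>t - t0\<bar> \<le> \<epsilon>" for t
    using D\<phi>[OF that(2)] U[OF that(2)] that(1) by (intro exI[of _ "(t - t0) ^ (j - 1) * U (t - t0)"]) auto
  define e where "e lam t = exp (\<i> * complex_of_real (lam * \<phi> t))" for lam t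
  have norm_e: "norm (e lam t) = 1" for lam t by (simp add: e_def norm_exp_i_times)
  have econt: "continuous_on S (e lam)" if "S \<subseteq> {t0 - \<epsilon>..t0 + \<epsilon>}" for S lam
    unfolding e_def[abs_def] using continuous_on_subset[OF cont that] by (intro continuous_intros)
  obtain C1 where C1: "C1 \<ge> 0" "\<And>lam a c. lam \<noteq> 0 \<Longrightarrow> 0 \<le> a \<Longrightarrow> a \<le> c \<Longrightarrow> c \<le> \<epsilon> \<Longrightarrow>
      norm (integral {a..c} (\<lambda>h. e lam (t0 + h))) \<le> C1 * \<bar>lam\<bar> powr (- 1 / real j)"
    using oscillatory_integral_right[of \<epsilon> j "\<lambda>h. \<phi> (t0 + h)" U U1] \<epsilon>(1) j(1) D DU U
      continuous_on_subset[OF U1, of "{0..\<epsilon>}"] unfolding e_def by auto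
  \<comment> \<open>The sign (-1)^j produced by the reflection goes into the unit, so the factor
    h^(j - 1) keeps its form.\<close>
  have D': "((\<lambda>h. \<phi> (t0 - h)) has_real_derivative h ^ (j - 1) * ((-1) ^ j * U (- h))) (at h)"
    if "\<bar>h\<bar> \<le> \<epsilon>" for h
  proof -
    obtain i where i: "j = Suc i" using j(1) by (cases j) auto
    have "((\<lambda>h. \<phi> (t0 - h)) has_real_derivative ((- h) ^ (j - 1) * U (- h)) * (-1)) (at h)"
      using D\<phi>[of "t0 - h"] that
      by (intro DERIV_chain2[where f = \<phi> and g = "\<lambda>h. t0 - h"]) (auto intro!: derivative_eq_intros)
    moreover have "((- h) ^ (j - 1) * U (- h)) * (-1) = h ^ (j - 1) * ((-1) ^ j * U (- h))"
      using power_minus[of h i] by (simp add: i)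
    ultimately show ?thesis by simp
  qed
  have DU': "((\<lambda>h. (-1) ^ j * U (- h)) has_real_derivative (-1) ^ j * (U1 (- h) * (-1))) (at h)"
    if "\<bar>h\<bar> \<le> \<epsilon>" for h
    by (intro DERIV_cmult DERIV_chain2[where f = U] DU) (use that in \<open>auto intro!: derivative_eq_intros\<close>)
  have U1': "continuous_on {0..\<epsilon>} (\<lambda>h. (-1) ^ j * (U1 (- h) * (-1)))"
    by (intro continuous_intros continuous_on_compose2[OF U1]) auto
  obtain C2 where C2: "C2 \<ge> 0" "\<And>lam a c. lam \<noteq> 0 \<Longrightarrow> 0 \<le> a \<Longrightarrow> a \<le> c \<Longrightarrow> c \<le> \<epsilon> \<Longrightarrow>
      norm (integral {a..c} (\<lambda>h. e lam (t0 - h))) \<le> C2 * \<bar>lam\<bar> powr (- 1 / real j)"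
    using oscillatory_integral_right[of \<epsilon> j "\<lambda>h. \<phi> (t0 - h)" "\<lambda>h. (-1) ^ j * U (- h)"
        "\<lambda>h. (-1) ^ j * (U1 (- h) * (-1))"] \<epsilon>(1) j(1) D' DU' U U1' unfolding e_def by auto
  have right: "norm (integral {a..c} (e lam)) \<le> C1 * \<bar>lam\<bar> powr (- 1 / real j)"
    if "lam \<noteq> 0" "t0 \<le> a" "a \<le> c" "c \<le> t0 + \<epsilon>" for lam a c
    using C1(2)[of lam "a - t0" "c - t0"] that integral_shift_real_ivl[of a t0 c "e lam"]
    by (simp add: add.commute)
  have left: "norm (integral {a..c} (e lam)) \<le> C2 * \<bar>lam\<bar> powr (- 1 / real j)"
    if "lam \<noteq> 0" "t0 - \<epsilon> \<le> a" "a \<le> c" "c \<le> t0" for lam a c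
  proof -
    have "integral {a..c} (e lam) = integral {a - t0..c - t0} (\<lambda>h. e lam (h + t0))"
      by (rule integral_shift_real_ivl[symmetric])
    also have "\<dots> = integral {t0 - c..t0 - a} (\<lambda>h. e lam (t0 - h))"
      using Henstock_Kurzweil_Integration.integral_reflect_real[of "t0 - a" "t0 - c" "\<lambda>h. e lam (t0 - h)"] by (simp add: add.commute)
    finally show ?thesis using C2(2)[of lam "t0 - c" "t0 - a"] that by simp
  qed
  have both: "norm (integral {a..c} (e lam)) \<le> (C1 + C2) * \<bar>lam\<bar> powr (- 1 / real j)"
    if "lam \<noteq> 0" "t0 - \<epsilon> \<le> a" "a \<le> c" "c \<le> t0 + \<epsilon>" for lam a c
  proof -
    let ?q = "\<bar>lam\<bar> powr (- 1 / real j)"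
    have q: "(C1 + C2) * ?q = C1 * ?q + C2 * ?q" "0 \<le> C1 * ?q" "0 \<le> C2 * ?q"
      using C1(1) C2(1) by (simp_all add: distrib_right)
    consider "t0 \<le> a" | "c \<le> t0" | "a < t0" "t0 < c" by linarith
    then show ?thesis
    proof cases
      case 1
      then show ?thesis using right[OF that(1) 1 that(3,4)] q by linarith
    next
      case 2
      then show ?thesis using left[OF that(1-3) 2] q by linarith
    next
      case 3
      then have "integral {a..t0} (e lam) + integral {t0..c} (e lam) = integral {a..c} (e lam)"
        using that
        by (intro Henstock_Kurzweil_Integration.integral_combine integrable_continuous_interval econt) auto
      then have "norm (integral {a..c} (e lam))
          \<le> norm (integral {a..t0} (e lam)) + norm (integral {t0..c} (e lam))"
        using norm_triangle_ineq by metis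
      then show ?thesis using left[of lam a t0] right[of lam t0 c] that 3 q by linarith
    qed
  qed
  \<comment> \<open>Passing from j to the common p weakens the decay only for \<bar>lam\<bar> \<ge>
    1. For smaller lam the power is at least 1, and the length 2 * \<epsilon> bounds the
    integral.\<close>
  have "norm (integral {a..c} (e lam)) \<le> (C1 + C2 + 2 * \<epsilon>) * \<bar>lam\<bar> powr (- 1 / real p)"
    if lam: "lam \<noteq> 0" and ac: "t0 - \<epsilon> \<le> a" "a \<le> c" "c \<le> t0 + \<epsilon>" for lam a c
  proof (cases "1 \<le> \<bar>lam\<bar>")
    case True
    have "- 1 / real j \<le> - 1 / real p" using j(1,2) by (simp add: divide_simps)
    then have "\<bar>lam\<bar> powr (- 1 / real j) \<le> \<bar>lam\<bar> powr (- 1 / real p)"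
      using True by (intro powr_mono) auto
    then have "(C1 + C2) * \<bar>lam\<bar> powr (- 1 / real j) \<le> (C1 + C2 + 2 * \<epsilon>) * \<bar>lam\<bar> powr (- 1 / real p)"
      using C1(1) C2(1) \<epsilon>(1) by (intro mult_mono) auto
    then show ?thesis using both[OF lam ac] by linarith
  next
    case False
    have "norm (integral {a..c} (e lam)) \<le> 1 * (c - a)"
      using ac by (intro integral_bound econt) (auto simp: norm_e)
    also have "\<dots> \<le> (C1 + C2 + 2 * \<epsilon>) * 1" using ac C1(1) C2(1) by simp
    also have "(1::real) \<le> \<bar>lam\<bar> powr (- 1 / real p)"
      using powr_mono_both'[of "1 / real p" 0 "\<bar>lam\<bar>" 1] False lam
      by (simp add: powr_minus_divide powr_le1)
    finally show ?thesis using C1(1) C2(1) \<epsilon>(1) by (simp add: mult_left_mono)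
  qed
  then show ?thesis
    using \<epsilon>(1) cont deriv C1(1) C2(1) unfolding e_def
    by (intro exI[of _ \<epsilon>] conjI exI[of _ "C1 + C2 + 2 * \<epsilon>"]) auto
qed

section \<open>From local to global on a segment\<close>

text \<open>Bolzano's bisection principle does the work of a finite subcover: when two intervals are
  joined, integrals split at the common point and the constants add. Continuity is carried along
  because the splitting requires integrability.\<close>

lemma oscillatory_integral_interval:
  fixes \<phi> :: "real \<Rightarrow> real"
  assumes "l \<le> u"
    and loc: "\<And>t0. l \<le> t0 \<Longrightarrow> t0 \<le> u \<Longrightarrow> \<exists>\<epsilon>>0. continuous_on {t0 - \<epsilon>..t0 + \<epsilon>} \<phi> \<and>
      (\<exists>C\<ge>0. \<forall>lam a c. lam \<noteq> 0 \<longrightarrow> t0 - \<epsilon> \<le> a \<longrightarrow> a \<le> c \<longrightarrow> c \<le> t0 + \<epsilon> \<longrightarrow>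
        norm (integral {a..c} (\<lambda>t. exp (\<i> * complex_of_real (lam * \<phi> t)))) \<le> C * \<bar>lam\<bar> powr (- 1 / real p))"
  shows "continuous_on {l..u} \<phi> \<and> (\<exists>C\<ge>0. \<forall>lam a c. lam \<noteq> 0 \<longrightarrow> l \<le> a \<longrightarrow> a \<le> c \<longrightarrow> c \<le> u \<longrightarrow>
        norm (integral {a..c} (\<lambda>t. exp (\<i> * complex_of_real (lam * \<phi> t)))) \<le> C * \<bar>lam\<bar> powr (- 1 / real p))"
  using \<open>l \<le> u\<close>
proof (induct rule: Bolzano)
  case (trans x y z)
  obtain C1 where C1: "C1 \<ge> 0" "\<And>lam a c. lam \<noteq> 0 \<Longrightarrow> x \<le> a \<Longrightarrow> a \<le> c \<Longrightarrow> c \<le> y \<Longrightarrow>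
        norm (integral {a..c} (\<lambda>t. exp (\<i> * complex_of_real (lam * \<phi> t)))) \<le> C1 * \<bar>lam\<bar> powr (- 1 / real p)"
    using trans(1) by metis
  obtain C2 where C2: "C2 \<ge> 0" "\<And>lam a c. lam \<noteq> 0 \<Longrightarrow> y \<le> a \<Longrightarrow> a \<le> c \<Longrightarrow> c \<le> z \<Longrightarrow>
        norm (integral {a..c} (\<lambda>t. exp (\<i> * complex_of_real (lam * \<phi> t)))) \<le> C2 * \<bar>lam\<bar> powr (- 1 / real p)"
    using trans(2) by metis
  have "{x..z} = {x..y} \<union> {y..z}" using trans(3,4) by auto
  then have cont: "continuous_on {x..z} \<phi>"
    using trans(1,2) by (metis continuous_on_closed_Un closed_real_atLeastAtMost)
  have "norm (integral {a..c} (\<lambda>t. exp (\<i> * complex_of_real (lam * \<phi> t)))) \<le> (C1 + C2) * \<bar>lam\<bar> powr (- 1 / real p)"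
    if ac: "lam \<noteq> 0" "x \<le> a" "a \<le> c" "c \<le> z" for lam a c
  proof -
    let ?q = "\<bar>lam\<bar> powr (- 1 / real p)" and ?e = "\<lambda>t. exp (\<i> * complex_of_real (lam * \<phi> t))"
    have q: "(C1 + C2) * ?q = C1 * ?q + C2 * ?q" "0 \<le> C1 * ?q" "0 \<le> C2 * ?q"
      using C1(1) C2(1) by (simp_all add: distrib_right)
    consider "y \<le> a" | "c \<le> y" | "a < y" "y < c" by linarith
    then show ?thesis
    proof cases
      case 1
      then show ?thesis using C2(2)[OF ac(1) 1 ac(3,4)] q by linarith
    next
      case 2
      then show ?thesis using C1(2)[OF ac(1-3) 2] q by linarith
    next
      case 3
      have "continuous_on {a..c} \<phi>" using cont ac by (rule_tac continuous_on_subset) auto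
      then have "integral {a..y} ?e + integral {y..c} ?e = integral {a..c} ?e"
        using 3
        by (intro Henstock_Kurzweil_Integration.integral_combine integrable_continuous_interval continuous_intros) auto
      then have "norm (integral {a..c} ?e) \<le> norm (integral {a..y} ?e) + norm (integral {y..c} ?e)"
        using norm_triangle_ineq by metis
      then show ?thesis using C1(2)[of lam a y] C2(2)[of lam y c] ac 3 q by linarith
    qed
  qed
  then show ?case using cont C1(1) C2(1) by (intro conjI exI[of _ "C1 + C2"]) auto
next
  case (local x)
  obtain \<epsilon> C where \<epsilon>: "\<epsilon> > 0" "continuous_on {x - \<epsilon>..x + \<epsilon>} \<phi>" "C \<ge> 0"
    and C: "\<And>lam a c. lam \<noteq> 0 \<Longrightarrow> x - \<epsilon> \<le> a \<Longrightarrow> a \<le> c \<Longrightarrow> c \<le> x + \<epsilon> \<Longrightarrow>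
        norm (integral {a..c} (\<lambda>t. exp (\<i> * complex_of_real (lam * \<phi> t)))) \<le> C * \<bar>lam\<bar> powr (- 1 / real p)"
    using loc[OF local] by metis
  show ?case
  proof (rule exI[of _ \<epsilon>], rule conjI[OF \<epsilon>(1)], intro allI impI conjI exI[of _ C] \<epsilon>(3))
    fix a b assume "a \<le> x \<and> x \<le> b \<and> b - a < \<epsilon>"
    then show "continuous_on {a..b} \<phi>"
      by (intro continuous_on_subset[OF \<epsilon>(2)]) auto
  qed (use C in auto)
qed

text \<open>The points of local constancy form an open set. So do the others within the segment:
  near such a point the derivative is nonzero elsewhere. Connectedness leaves all or none.\<close>

lemma locally_constant_dichotomy:
  fixes \<phi> :: "real \<Rightarrow> real"
  assumes "l \<le> u"
    and loc: "\<And>t0. l \<le> t0 \<Longrightarrow> t0 \<le> u \<Longrightarrow>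
      (\<exists>\<eta>>0. \<forall>t. \<bar>t - t0\<bar> < \<eta> \<longrightarrow> \<phi> t = \<phi> t0) \<or>
      (\<exists>\<epsilon>>0. \<forall>t. t \<noteq> t0 \<longrightarrow> \<bar>t - t0\<bar> \<le> \<epsilon> \<longrightarrow> (\<exists>D. D \<noteq> 0 \<and> (\<phi> has_real_derivative D) (at t)))"
  shows "(\<forall>t\<in>{l..u}. \<phi> t = \<phi> l) \<or>
    (\<forall>t0\<in>{l..u}. \<not> (\<exists>\<eta>>0. \<forall>t. \<bar>t - t0\<bar> < \<eta> \<longrightarrow> \<phi> t = \<phi> t0))"
proof -
  define K where "K t0 \<longleftrightarrow> (\<exists>\<eta>>0. \<forall>t. \<bar>t - t0\<bar> < \<eta> \<longrightarrow> \<phi> t = \<phi> t0)" for t0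
  have near: "\<exists>\<eta>>0. \<forall>t. \<bar>t - t0\<bar> < \<eta> \<longrightarrow> K t" if K0: "K t0" for t0
  proof -
    obtain \<eta> where \<eta>: "\<eta> > 0" "\<forall>t. \<bar>t - t0\<bar> < \<eta> \<longrightarrow> \<phi> t = \<phi> t0" using K0 unfolding K_def by blast
    have "K t" if t: "\<bar>t - t0\<bar> < \<eta> / 2" for t
      unfolding K_def
    proof (intro exI[of _ "\<eta> / 2"] conjI allI impI)
      fix t' assume "\<bar>t' - t\<bar> < \<eta> / 2"
      then have "\<bar>t' - t0\<bar> < \<eta>" "\<bar>t - t0\<bar> < \<eta>" using t \<eta>(1) by linarith+
      then show "\<phi> t' = \<phi> t" using \<eta>(2) by metis
    qed (use \<eta>(1) in simp)
    then show ?thesis using \<eta>(1) by (intro exI[of _ "\<eta> / 2"]) auto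
  qed
  have not_K: "\<not> K t" if "(\<phi> has_real_derivative D) (at t)" "D \<noteq> 0" for t D
  proof
    assume "K t"
    then obtain \<eta> where \<eta>: "\<eta> > 0" "\<forall>s. \<bar>s - t\<bar> < \<eta> \<longrightarrow> \<phi> s = \<phi> t" unfolding K_def by blast
    have "((\<lambda>_. \<phi> t) has_real_derivative D) (at t)"
      using that(1) \<eta>(1)
    proof (rule has_field_derivative_transform_within)
      show "\<phi> s = \<phi> t" if "dist s t < \<eta>" for s
        using \<eta>(2) that unfolding dist_real_def by blast
    qed simp
    then show False using DERIV_unique[OF _ DERIV_const] that(2) by blast
  qed
  have "(\<forall>t\<in>{l..u}. K t) \<or> (\<forall>t\<in>{l..u}. \<not> K t)"
    using assms(1)
  proof (induct rule: Bolzano)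
    case (trans a b c)
    then have "b \<in> {a..b}" "b \<in> {b..c}" "\<And>t. t \<in> {a..c} \<Longrightarrow> t \<in> {a..b} \<or> t \<in> {b..c}" by auto
    then show ?case using trans(1,2) by metis
  next
    case (local x)
    show ?case
    proof (cases "K x")
      case True
      then obtain \<eta> where "\<eta> > 0" "\<forall>t. \<bar>t - x\<bar> < \<eta> \<longrightarrow> K t" using near by blast
      then show ?thesis by (intro exI[of _ \<eta>]) auto
    next
      case False
      then obtain \<epsilon> where \<epsilon>: "\<epsilon> > 0" "\<forall>t. t \<noteq> x \<longrightarrow> \<bar>t - x\<bar> \<le> \<epsilon> \<longrightarrow>
          (\<exists>D. D \<noteq> 0 \<and> (\<phi> has_real_derivative D) (at t))"
        using loc[OF local] unfolding K_def by blast
      have "\<not> K t" if "\<bar>t - x\<bar> \<le> \<epsilon>" for t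
        using \<epsilon>(2) that not_K False by (cases "t = x") blast+
      then show ?thesis using \<epsilon>(1) by (intro exI[of _ \<epsilon>]) auto
    qed
  qed
  then show ?thesis
  proof
    assume all: "\<forall>t\<in>{l..u}. K t"
    have "\<phi> l = \<phi> t" if "t \<in> {l..u}" for t
    proof -
      have "l \<le> t" using that by simp
      then show ?thesis
      proof (induct rule: Bolzano)
        case (local x)
        then have "K x" using all that by auto
        then obtain \<eta> where \<eta>: "\<eta> > 0" "\<forall>s. \<bar>s - x\<bar> < \<eta> \<longrightarrow> \<phi> s = \<phi> x" unfolding K_def by blast
        show ?case
        proof (intro exI[of _ \<eta>] conjI allI impI \<eta>(1))
          fix a b assume "a \<le> x \<and> x \<le> b \<and> b - a < \<eta>"
          then have "\<bar>a - x\<bar> < \<eta>" "\<bar>b - x\<bar> < \<eta>" by linarith+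
          then show "\<phi> a = \<phi> b" using \<eta>(2) by metis
        qed
      qed simp
    qed
    then show ?thesis by metis
  next
    assume "\<forall>t\<in>{l..u}. \<not> K t"
    then show ?thesis unfolding K_def by blast
  qed
qed

text \<open>The primitive F of the exponential is bounded by B, and \<psi> vanishes at both
  endpoints, so the derivative moves to \<psi> without boundary terms.\<close>

lemma oscillatory_integral_by_parts:
  fixes \<phi> :: "real \<Rightarrow> real" and \<psi> \<psi>' :: "real \<Rightarrow> complex"
  assumes "l \<le> u" and cont: "continuous_on {l..u} \<phi>"
    and B: "\<And>c. l \<le> c \<Longrightarrow> c \<le> u \<Longrightarrow> norm (integral {l..c} (\<lambda>t. exp (\<i> * complex_of_real (lam * \<phi> t)))) \<le> B"
    and \<psi>: "\<And>t. (\<psi> has_vector_derivative \<psi>' t) (at t)" and \<psi>'_cont: "continuous_on UNIV \<psi>'"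
    and supp: "\<And>t. t \<notin> {l<..<u} \<Longrightarrow> \<psi> t = 0"
  shows "norm (LINT t|lborel. exp (\<i> * complex_of_real (lam * \<phi> t)) * \<psi> t) \<le> B * (LINT t|lborel. norm (\<psi>' t))"
proof -
  define e where "e t = exp (\<i> * complex_of_real (lam * \<phi> t))" for t
  define F where "F c = integral {l..c} e" for c
  have econt: "continuous_on {l..u} e" unfolding e_def by (intro continuous_intros cont)
  have \<psi>cont: "continuous_on S \<psi>" for S
    using \<psi> by (intro continuous_at_imp_continuous_on) (auto intro: has_vector_derivative_continuous)
  have F: "(F has_vector_derivative e t) (at t within {l..u})" if "t \<in> {l..u}" for t
    unfolding F_def by (rule integral_has_vector_derivative[OF econt that])
  have Fcont: "continuous_on {l..u} F" using F by (rule continuous_on_vector_derivative)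
  have "((\<lambda>t. F t * \<psi> t) has_vector_derivative (F t * \<psi>' t + e t * \<psi> t)) (at t within {l..u})"
    if "t \<in> {l..u}" for t
    using has_vector_derivative_mult[OF F[OF that] has_vector_derivative_at_within[OF \<psi>]] .
  then have "((\<lambda>t. F t * \<psi>' t + e t * \<psi> t) has_integral (F u * \<psi> u - F l * \<psi> l)) {l..u}"
    by (intro fundamental_theorem_of_calculus assms(1))
  then have total: "((\<lambda>t. F t * \<psi>' t + e t * \<psi> t) has_integral 0) {l..u}" using supp by simp
  have "(\<lambda>t. F t * \<psi>' t) integrable_on {l..u}"
    by (intro integrable_continuous_interval continuous_intros Fcont continuous_on_subset[OF \<psi>'_cont]) auto
  then have F\<psi>': "((\<lambda>t. F t * \<psi>' t) has_integral integral {l..u} (\<lambda>t. F t * \<psi>' t)) {l..u}"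
    by (rule integrable_integral)
  have e\<psi>: "integral {l..u} (\<lambda>t. e t * \<psi> t) = - integral {l..u} (\<lambda>t. F t * \<psi>' t)"
    using has_integral_diff[OF total F\<psi>'] by (simp add: integral_unique)
  have \<psi>'_supp: "\<psi>' t = 0" if "t \<notin> {l..u}" for t
  proof -
    have "((\<lambda>_. 0) has_vector_derivative \<psi>' t) (at t)"
      using \<psi>[of t]
    proof (rule has_vector_derivative_transform_within_open)
      show "open (- {l..u})" by (rule open_Compl) simp
    qed (use that supp in auto)
    then show ?thesis using vector_derivative_unique_at has_vector_derivative_const by blast
  qed
  \<comment> \<open>The statement uses Lebesgue integrals over the line, the calculus uses gauge
    integrals over the segment; they agree for functions continuous on the segment and zero
    outside.\<close>
  have LINT_eq: "(LINT t|lborel. g t) = integral {l..u} g" if "continuous_on {l..u} g" "\<And>t. t \<notin> {l..u} \<Longrightarrow> g t = 0"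
    for g :: "real \<Rightarrow> 'b::euclidean_space"
  proof -
    have "(LINT t|lborel. g t) = (LINT t:{l..u}|lborel. g t)"
      unfolding set_lebesgue_integral_def
      by (intro Bochner_Integration.integral_cong) (use that(2) in \<open>auto simp: indicator_def\<close>)
    also have "\<dots> = integral {l..u} g"
      by (rule set_borel_integral_eq_integral(2)[OF borel_integrable_atLeastAtMost'[OF that(1)]])
    finally show ?thesis .
  qed
  have "(LINT t|lborel. e t * \<psi> t) = integral {l..u} (\<lambda>t. e t * \<psi> t)"
    using supp by (intro LINT_eq continuous_intros econt \<psi>cont) auto
  also have "norm \<dots> \<le> integral {l..u} (\<lambda>t. B * norm (\<psi>' t))"
    unfolding e\<psi> norm_minus_cancel
  proof (rule integral_norm_bound_integral)
    show "(\<lambda>t. F t * \<psi>' t) integrable_on {l..u}" by fact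
    show "(\<lambda>t. B * norm (\<psi>' t)) integrable_on {l..u}"
      by (intro integrable_continuous_interval continuous_intros continuous_on_subset[OF \<psi>'_cont]) auto
    show "norm (F t * \<psi>' t) \<le> B * norm (\<psi>' t)" if "t \<in> {l..u}" for t
      using B[of t] that unfolding norm_mult F_def e_def by (intro mult_right_mono) auto
  qed
  also have "\<dots> = B * integral {l..u} (\<lambda>t. norm (\<psi>' t))" by simp
  also have "integral {l..u} (\<lambda>t. norm (\<psi>' t)) = (LINT t|lborel. norm (\<psi>' t))"
    using \<psi>'_supp by (intro LINT_eq[symmetric] continuous_intros continuous_on_subset[OF \<psi>'_cont]) auto
  finally show ?thesis unfolding e_def .
qed

section \<open>Uniformity over the ball\<close>

text \<open>The closed ball is needed because the endpoints of a chord lie on the sphere and must be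
  covered by good intervals too.\<close>

lemma uniform_order_on_cball:
  fixes f :: "real^'n \<Rightarrow> real"
  assumes "cball 0 r \<subseteq> U" "real_analytic_on f U"
  shows "\<exists>p\<ge>1. \<forall>x\<in>cball 0 r. \<exists>b. \<exists>\<delta>>0.
    (\<forall>h. \<bar>h\<bar> < \<delta> \<longrightarrow> (\<lambda>j. b j * h ^ j) sums f (set_coord k (x $ k + h) x)) \<and>
    ((\<forall>j\<in>{1..p}. b j = 0) \<longrightarrow> (\<forall>j\<ge>1. b j = 0))"
proof -
  define Q where "Q p x \<longleftrightarrow> (\<exists>b. \<exists>\<delta>>0.
    (\<forall>h. \<bar>h\<bar> < \<delta> \<longrightarrow> (\<lambda>j. b j * h ^ j) sums f (set_coord k (x $ k + h) x)) \<and>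
    ((\<forall>j\<in>{1..p}. b j = 0) \<longrightarrow> (\<forall>j\<ge>1. b j = 0)))" for p :: nat and x
  have Q_mono: "Q p' x" if "Q p x" "p \<le> p'" for p p' x
  proof -
    have "{1..p} \<subseteq> {1..p'}" using \<open>p \<le> p'\<close> by auto
    then show ?thesis using \<open>Q p x\<close> unfolding Q_def by (meson subsetD)
  qed
  have "\<forall>a\<in>cball 0 r. \<exists>p \<epsilon>. \<epsilon> > 0 \<and> (\<forall>x\<in>ball a \<epsilon>. Q p x)"
    unfolding Q_def by (rule ballI, rule local_uniform_order[OF assms(2)]) (use assms(1) in blast)
  then obtain \<pi> \<epsilon> where loc: "\<forall>a\<in>cball 0 r. \<epsilon> a > 0 \<and> (\<forall>x\<in>ball a (\<epsilon> a). Q (\<pi> a) x)"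
    by metis
  have "cball 0 r \<subseteq> (\<Union>a\<in>cball 0 r. ball a (\<epsilon> a))" using loc by force
  then obtain D where D: "D \<subseteq> cball 0 r" "finite D" "cball 0 r \<subseteq> (\<Union>a\<in>D. ball a (\<epsilon> a))"
    using compactE_image[OF compact_cball, of "cball 0 r" "\<lambda>a. ball a (\<epsilon> a)" 0 r] by auto
  \<comment> \<open>The sum dominates each local order bound, and \<open>Suc\<close> makes p
    positive.\<close>
  define p where "p = Suc (sum \<pi> D)"
  have "Q p x" if x: "x \<in> cball 0 r" for x
  proof -
    obtain a where a: "a \<in> D" "x \<in> ball a (\<epsilon> a)" using D(3) x by blast
    have "\<pi> a \<le> p" unfolding p_def using member_le_sum[of a D \<pi>] a(1) D(2) by simp
    then show ?thesis using Q_mono loc a D(1) by blast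
  qed
  moreover have "p \<ge> 1" by (simp add: p_def)
  ultimately show ?thesis unfolding Q_def by blast
qed

section \<open>Restriction to lines and the final estimate\<close>

lemma set_coord_set_coord [simp]: "set_coord k t (set_coord k u x) = set_coord k t x"
  by (simp add: set_coord_def vec_eq_iff)

lemma set_coord_nth_same [simp]: "set_coord k t x $ k = t"
  by (simp add: set_coord_def)

lemma set_coord_eq: "set_coord k t x = t *\<^sub>R axis k 1 + set_coord k 0 x"
  by (simp add: set_coord_def vec_eq_iff axis_def)

lemma norm_set_coord: "(norm (set_coord k t x))\<^sup>2 = t\<^sup>2 + (norm (set_coord k 0 x))\<^sup>2"
proof -
  have "orthogonal (t *\<^sub>R axis k 1) (set_coord k 0 x)"
    by (simp add: orthogonal_def inner_axis')
  from norm_add_Pythagorean[OF this] show ?thesis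
    unfolding set_coord_eq[of k t x] by simp
qed

lemma C1_function_along_coordinate:
  fixes \<phi> :: "real^'n \<Rightarrow> 'b::real_normed_vector"
  assumes "C1_function \<phi>"
  shows "((\<lambda>t. \<phi> (set_coord k t x)) has_vector_derivative partial_deriv k \<phi> (set_coord k t x)) (at t)"
    and "continuous_on UNIV (\<lambda>t. partial_deriv k \<phi> (set_coord k t x))"
proof -
  obtain g where g: "\<And>z. (\<phi> has_derivative blinfun_apply (g z)) (at z)" and gcont: "continuous_on UNIV g"
    using assms unfolding C1_function_def by blast
  have affine: "(\<lambda>t. set_coord k t x) = (\<lambda>t. t *\<^sub>R axis k 1 + set_coord k 0 x)"
    by (rule ext) (rule set_coord_eq)
  have line: "((\<lambda>t. set_coord k t x) has_derivative (\<lambda>h. h *\<^sub>R axis k 1)) (at t)" for t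
    unfolding affine by (auto intro!: derivative_eq_intros)
  have der: "((\<lambda>t. \<phi> (set_coord k t x)) has_vector_derivative g (set_coord k t x) (axis k 1)) (at t)" for t
    using has_derivative_compose[OF line g] unfolding has_vector_derivative_def
    by (simp add: blinfun.scaleR_right)
  have pd: "partial_deriv k \<phi> (set_coord k t x) = g (set_coord k t x) (axis k 1)" for t
    unfolding partial_deriv_def using vector_derivative_at[OF der] by simp
  show "((\<lambda>t. \<phi> (set_coord k t x)) has_vector_derivative partial_deriv k \<phi> (set_coord k t x)) (at t)"
    unfolding pd by (rule der)
  have "continuous_on UNIV (\<lambda>t. set_coord k t x)"
    unfolding affine by (intro continuous_intros)
  then show "continuous_on UNIV (\<lambda>t. partial_deriv k \<phi> (set_coord k t x))"
    unfolding pd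
    by (intro continuous_intros continuous_on_compose2[OF gcont]) auto
qed

text \<open>The amplitude and lam are quantified inside, so that a constant C chosen for one line
  serves all of them.\<close>

definition line_estimate :: "(real^'n \<Rightarrow> real) \<Rightarrow> real \<Rightarrow> 'n \<Rightarrow> nat \<Rightarrow> real^'n \<Rightarrow> real \<Rightarrow> bool" where
  "line_estimate f r k p x C \<longleftrightarrow>
    (\<forall>\<phi>. C1_function \<phi> \<and> (\<forall>x. x \<notin> ball 0 r \<longrightarrow> \<phi> x = 0) \<longrightarrow>
      (\<forall>lam::real. lam \<noteq> 0 \<longrightarrow>
        norm (osc_integral k f \<phi> lam x)
          \<le> C * ((SUP t. norm (\<phi> (set_coord k t x)))
                   + (LINT t|lborel. norm (partial_deriv k \<phi> (set_coord k t x))))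
            * \<bar>lam\<bar> powr (- 1 / real p)))"

text \<open>Equality of the predicates, for every C, makes a choice by \<open>SOME\<close> give the
  same value all along a line.\<close>

lemma line_estimate_set_coord: "line_estimate f r k p (set_coord k t x) C = line_estimate f r k p x C"
  by (simp add: line_estimate_def osc_integral_def)

text \<open>The line meets the open ball in an open interval, so the amplitude vanishes at both
  endpoints and integration by parts applies.\<close>

lemma line_estimateI:
  fixes f :: "real^'n \<Rightarrow> real"
  assumes s: "s > 0" and line: "\<And>t. set_coord k t x \<in> ball 0 r \<longleftrightarrow> t \<in> {-s<..<s}"
    and cont: "continuous_on {-s..s} (\<lambda>t. f (set_coord k t x))" and "C \<ge> 0"
    and C: "\<And>lam a c. lam \<noteq> 0 \<Longrightarrow> -s \<le> a \<Longrightarrow> a \<le> c \<Longrightarrow> c \<le> s \<Longrightarrow>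
        norm (integral {a..c} (\<lambda>t. exp (\<i> * complex_of_real (lam * f (set_coord k t x)))))
          \<le> C * \<bar>lam\<bar> powr (- 1 / real p)"
  shows "line_estimate f r k p x C"
  unfolding line_estimate_def
proof (intro allI impI, elim conjE)
  fix \<phi> :: "real^'n \<Rightarrow> complex" and lam :: real
  assume \<phi>: "C1_function \<phi>" and supp: "\<forall>x. x \<notin> ball 0 r \<longrightarrow> \<phi> x = 0" and lam: "lam \<noteq> 0"
  let ?\<psi> = "\<lambda>t. \<phi> (set_coord k t x)"
  let ?I = "LINT t|lborel. norm (partial_deriv k \<phi> (set_coord k t x))"
  note D = C1_function_along_coordinate[OF \<phi>, of k x]
  have zero: "?\<psi> t = 0" if "t \<notin> {-s<..<s}" for t using supp line that by blast
  have "norm (osc_integral k f \<phi> lam x) \<le> (C * \<bar>lam\<bar> powr (- 1 / real p)) * ?I"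
    unfolding osc_integral_def
  proof (rule oscillatory_integral_by_parts[OF _ cont _ D zero])
    show "norm (integral {-s..c} (\<lambda>t. exp (\<i> * complex_of_real (lam * f (set_coord k t x)))))
        \<le> C * \<bar>lam\<bar> powr (- 1 / real p)" if "-s \<le> c" "c \<le> s" for c
      using C[of lam "-s" c] lam that by simp
  qed (use s in auto)
  \<comment> \<open>A real \<open>SUP\<close> is meaningful only for a bounded range, so boundedness
    is derived first, from continuity on the compact segment and vanishing outside.\<close>
  moreover have "0 \<le> (SUP t. norm (?\<psi> t))"
  proof -
    have "continuous_on {-s..s} ?\<psi>"
      using D(1) by (intro continuous_at_imp_continuous_on) (auto intro: has_vector_derivative_continuous)
    then have "bounded (?\<psi> ` {-s..s})"
      by (intro compact_imp_bounded compact_continuous_image compact_Icc)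
    then obtain M where M: "\<forall>t\<in>{-s..s}. norm (?\<psi> t) \<le> M" unfolding bounded_iff by auto
    have "norm (?\<psi> t) \<le> max M 0" for t
    proof (cases "t \<in> {-s<..<s}")
      case True
      then show ?thesis using M by (auto simp: le_max_iff_disj)
    qed (simp add: zero)
    then have "bdd_above (range (\<lambda>t. norm (?\<psi> t)))" by (auto intro!: bdd_aboveI2)
    then have "norm (?\<psi> 0) \<le> (SUP t. norm (?\<psi> t))" by (rule cSUP_upper[OF UNIV_I])
    then show ?thesis using norm_ge_zero order_trans by blast
  qed
  then have "C * \<bar>lam\<bar> powr (- 1 / real p) * ?I
      \<le> C * \<bar>lam\<bar> powr (- 1 / real p) * ((SUP t. norm (?\<psi> t)) + ?I)"
    using \<open>C \<ge> 0\<close> by (intro mult_left_mono) auto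
  ultimately show "norm (osc_integral k f \<phi> lam x)
      \<le> C * ((SUP t. norm (?\<psi> t)) + ?I) * \<bar>lam\<bar> powr (- 1 / real p)"
    by (simp add: mult_ac)
qed

text \<open>At each point of the closed chord the phase is either locally constant or of order at
  most p. Nonconstancy rules out the first case along the whole chord, and the local estimates can
  be joined.\<close>

lemma line_estimate_exists:
  fixes f :: "real^'n \<Rightarrow> real"
  assumes order: "\<And>z. z \<in> cball 0 r \<Longrightarrow> \<exists>b. \<exists>\<delta>>0.
      (\<forall>h. \<bar>h\<bar> < \<delta> \<longrightarrow> (\<lambda>j. b j * h ^ j) sums f (set_coord k (z $ k + h) z)) \<and>
      ((\<forall>j\<in>{1..p}. b j = 0) \<longrightarrow> (\<forall>j\<ge>1. b j = 0))"
    and "r > 0"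
    and nonconst: "\<not> (\<lambda>t. f (set_coord k t x)) constant_on {t. set_coord k t x \<in> ball 0 r}"
  shows "\<exists>C. line_estimate f r k p x C"
proof -
  define \<phi> where "\<phi> t = f (set_coord k t x)" for t
  define q where "q = (norm (set_coord k 0 x))\<^sup>2"
  have ball: "set_coord k t x \<in> ball 0 r \<longleftrightarrow> t\<^sup>2 + q < r\<^sup>2" for t
    using norm_set_coord[of k t x] abs_le_square_iff[of r "norm (set_coord k t x)"] \<open>r > 0\<close>
    by (auto simp: q_def not_le[symmetric])
  have cball: "set_coord k t x \<in> cball 0 r \<longleftrightarrow> t\<^sup>2 + q \<le> r\<^sup>2" for t
    using norm_set_coord[of k t x] abs_le_square_iff[of "norm (set_coord k t x)" r] \<open>r > 0\<close>
    by (auto simp: q_def)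
  \<comment> \<open>A line that misses the open ball counts as constant, the segment being empty;
    hence the chord has positive half-length s.\<close>
  have "q < r\<^sup>2"
  proof (rule ccontr)
    assume "\<not> q < r\<^sup>2"
    then have "{t. set_coord k t x \<in> ball 0 r} = {}"
      unfolding ball using zero_le_power2 by (smt (verit) Collect_empty_eq)
    then show False using nonconst by (simp add: constant_on_def)
  qed
  define s where "s = sqrt (r\<^sup>2 - q)"
  have s: "s > 0" "s\<^sup>2 = r\<^sup>2 - q" using \<open>q < r\<^sup>2\<close> by (simp_all add: s_def)
  have ball_s: "set_coord k t x \<in> ball 0 r \<longleftrightarrow> t \<in> {-s<..<s}" for t
    using abs_le_square_iff[of s t] s unfolding ball by auto
  have cball_s: "set_coord k t x \<in> cball 0 r" if "t \<in> {-s..s}" for t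
    using abs_le_square_iff[of t s] s that unfolding cball by auto
  define K where "K t0 \<longleftrightarrow> (\<exists>\<eta>>0. \<forall>t. \<bar>t - t0\<bar> < \<eta> \<longrightarrow> \<phi> t = \<phi> t0)" for t0
  define L where "L t0 \<epsilon> \<longleftrightarrow> continuous_on {t0 - \<epsilon>..t0 + \<epsilon>} \<phi> \<and>
      (\<forall>t. t \<noteq> t0 \<longrightarrow> \<bar>t - t0\<bar> \<le> \<epsilon> \<longrightarrow> (\<exists>D. D \<noteq> 0 \<and> (\<phi> has_real_derivative D) (at t))) \<and>
      (\<exists>C\<ge>0. \<forall>lam a c. lam \<noteq> 0 \<longrightarrow> t0 - \<epsilon> \<le> a \<longrightarrow> a \<le> c \<longrightarrow> c \<le> t0 + \<epsilon> \<longrightarrow>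
        norm (integral {a..c} (\<lambda>t. exp (\<i> * complex_of_real (lam * \<phi> t)))) \<le> C * \<bar>lam\<bar> powr (- 1 / real p))"
    for t0 \<epsilon>
  have dich: "K t0 \<or> (\<exists>\<epsilon>>0. L t0 \<epsilon>)" if t0: "-s \<le> t0" "t0 \<le> s" for t0
  proof -
    obtain b \<delta> where \<delta>: "\<delta> > 0" and sums: "\<forall>h. \<bar>h\<bar> < \<delta> \<longrightarrow> (\<lambda>j. b j * h ^ j) sums \<phi> (t0 + h)"
      and b: "(\<forall>j\<in>{1..p}. b j = 0) \<longrightarrow> (\<forall>j\<ge>1. b j = 0)"
      using order[OF cball_s[of t0]] t0 unfolding \<phi>_def by auto
    show ?thesis
    proof (cases "\<forall>j\<in>{1..p}. b j = 0")
      case True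
      \<comment> \<open>This is where the uniform p enters: once the coefficients of orders 1 to p
        vanish, all higher ones do, and the phase is locally constant.\<close>
      have "\<phi> t = b 0" if t: "\<bar>t - t0\<bar> < \<delta>" for t
      proof -
        have "(\<lambda>j. b j * (t - t0) ^ j) = (\<lambda>j. if j = 0 then b 0 else 0)"
          using b True by (auto simp: fun_eq_iff)
        then show ?thesis
          using sums t sums_single[of 0 "\<lambda>_. b 0"] sums_unique2 by fastforce
      qed
      then have "K t0" unfolding K_def using \<delta> by (intro exI[of _ \<delta>]) auto
      then show ?thesis ..
    next
      case False
      then obtain j where j: "1 \<le> j" "j \<le> p" "b j \<noteq> 0" "\<And>m. 1 \<le> m \<Longrightarrow> m < j \<Longrightarrow> b m = 0"
        using exists_least_iff[of "\<lambda>j. 1 \<le> j \<and> j \<le> p \<and> b j \<noteq> 0"] by auto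
      have "\<exists>\<epsilon>>0. L t0 \<epsilon>"
        unfolding L_def by (rule oscillatory_integral_local[of \<delta> b]) (use sums \<delta> j in auto)
      then show ?thesis ..
    qed
  qed
  have "(\<forall>t\<in>{-s..s}. \<phi> t = \<phi> (-s)) \<or> (\<forall>t0\<in>{-s..s}. \<not> K t0)"
    unfolding K_def
  proof (rule locally_constant_dichotomy)
    fix t0 assume "-s \<le> t0" "t0 \<le> s"
    from dich[OF this]
    show "(\<exists>\<eta>>0. \<forall>t. \<bar>t - t0\<bar> < \<eta> \<longrightarrow> \<phi> t = \<phi> t0) \<or>
      (\<exists>\<epsilon>>0. \<forall>t. t \<noteq> t0 \<longrightarrow> \<bar>t - t0\<bar> \<le> \<epsilon> \<longrightarrow> (\<exists>D. D \<noteq> 0 \<and> (\<phi> has_real_derivative D) (at t)))"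
    proof (elim disjE exE conjE)
      show ?thesis if "K t0" using that unfolding K_def by (rule disjI1)
      show ?thesis if "0 < \<epsilon>" "L t0 \<epsilon>" for \<epsilon>
        by (rule disjI2) (use that in \<open>auto simp: L_def intro!: exI[of _ \<epsilon>]\<close>)
    qed
  qed (use s in simp)
  moreover have "\<not> (\<forall>t\<in>{-s..s}. \<phi> t = \<phi> (-s))"
  proof
    assume const: "\<forall>t\<in>{-s..s}. \<phi> t = \<phi> (-s)"
    have "{-s<..<s} \<subseteq> {-s..s}" by auto
    then have "\<phi> constant_on {t. set_coord k t x \<in> ball 0 r}"
      unfolding constant_on_def ball_s Collect_mem_eq using const by blast
    then show False using nonconst unfolding \<phi>_def by blast
  qed
  ultimately have L: "\<exists>\<epsilon>>0. L t0 \<epsilon>" if "-s \<le> t0" "t0 \<le> s" for t0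
    using dich[OF that] that by auto
  have "continuous_on {-s..s} \<phi> \<and> (\<exists>C\<ge>0. \<forall>lam a c. lam \<noteq> 0 \<longrightarrow> -s \<le> a \<longrightarrow> a \<le> c \<longrightarrow> c \<le> s \<longrightarrow>
        norm (integral {a..c} (\<lambda>t. exp (\<i> * complex_of_real (lam * \<phi> t)))) \<le> C * \<bar>lam\<bar> powr (- 1 / real p))"
  proof (rule oscillatory_integral_interval)
    fix t0 assume "-s \<le> t0" "t0 \<le> s"
    then obtain \<epsilon> where "\<epsilon> > 0" "L t0 \<epsilon>" using L by blast
    then show "\<exists>\<epsilon>>0. continuous_on {t0 - \<epsilon>..t0 + \<epsilon>} \<phi> \<and>
      (\<exists>C\<ge>0. \<forall>lam a c. lam \<noteq> 0 \<longrightarrow> t0 - \<epsilon> \<le> a \<longrightarrow> a \<le> c \<longrightarrow> c \<le> t0 + \<epsilon> \<longrightarrow>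
        norm (integral {a..c} (\<lambda>t. exp (\<i> * complex_of_real (lam * \<phi> t)))) \<le> C * \<bar>lam\<bar> powr (- 1 / real p))"
      unfolding L_def by (intro exI[of _ \<epsilon>]) simp
  qed (use s in simp)
  then obtain C where cont: "continuous_on {-s..s} \<phi>" and "C \<ge> 0" and C: "\<forall>lam a c. lam \<noteq> 0 \<longrightarrow> -s \<le> a \<longrightarrow>
        a \<le> c \<longrightarrow> c \<le> s \<longrightarrow>
        norm (integral {a..c} (\<lambda>t. exp (\<i> * complex_of_real (lam * \<phi> t)))) \<le> C * \<bar>lam\<bar> powr (- 1 / real p)"
    by blast
  have "line_estimate f r k p x C"
    by (rule line_estimateI[OF s(1) ball_s _ \<open>C \<ge> 0\<close>]) (use cont C in \<open>simp_all add: \<phi>_def\<close>)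
  then show ?thesis ..
qed

theorem corollary2p1p3:
  fixes f :: "real^'n \<Rightarrow> real" and r :: real and U :: "(real^'n) set" and k :: 'n
  assumes "r > 0"
    and "open U" and "cball 0 r \<subseteq> U"
    and "real_analytic_on f U"
  shows "\<exists>(p::nat) (A :: real^'n \<Rightarrow> real).
    p > 0 \<and>
    (\<forall>x t. A (set_coord k t x) = A x) \<and>
    (\<forall>\<phi> :: real^'n \<Rightarrow> complex.
      C1_function \<phi> \<and> (\<forall>x. x \<notin> ball 0 r \<longrightarrow> \<phi> x = 0) \<longrightarrow>
      (\<forall>x.
        (\<lambda>t. f (set_coord k t x)) constant_on {t. set_coord k t x \<in> ball 0 r} \<or>
        (\<forall>lam::real. lam \<noteq> 0 \<longrightarrow>
          norm (osc_integral k f \<phi> lam x)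
            \<le> A x * ((SUP t. norm (\<phi> (set_coord k t x)))
                     + (LINT t|lborel. norm (partial_deriv k \<phi> (set_coord k t x))))
              * \<bar>lam\<bar> powr (- 1 / real p))))"
proof -
  obtain p where "p \<ge> 1" and order: "\<forall>z\<in>cball 0 r. \<exists>b. \<exists>\<delta>>0.
      (\<forall>h. \<bar>h\<bar> < \<delta> \<longrightarrow> (\<lambda>j. b j * h ^ j) sums f (set_coord k (z $ k + h) z)) \<and>
      ((\<forall>j\<in>{1..p}. b j = 0) \<longrightarrow> (\<forall>j\<ge>1. b j = 0))"
    using uniform_order_on_cball[OF assms(3,4), of k] by blast
  \<comment> \<open>On lines where f is constant this choice may be an arbitrary real; the first
    alternative of the conclusion covers them.\<close>
  define A where "A x = (SOME C. line_estimate f r k p x C)" for x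
  have A: "line_estimate f r k p x (A x)"
    if nonconst: "\<not> (\<lambda>t. f (set_coord k t x)) constant_on {t. set_coord k t x \<in> ball 0 r}" for x
  proof -
    have "\<exists>C. line_estimate f r k p x C"
      using order by (intro line_estimate_exists[OF _ assms(1) nonconst]) blast
    then show ?thesis unfolding A_def by (rule someI_ex)
  qed
  show ?thesis
  proof (intro exI[of _ p] exI[of _ A] conjI allI impI)
    show "p > 0" using \<open>p \<ge> 1\<close> by simp
    show "A (set_coord k t x) = A x" for x t
      by (simp add: A_def line_estimate_set_coord)
  next
    fix \<phi> :: "real^'n \<Rightarrow> complex" and x
    assume "C1_function \<phi> \<and> (\<forall>x. x \<notin> ball 0 r \<longrightarrow> \<phi> x = 0)"
    then show "(\<lambda>t. f (set_coord k t x)) constant_on {t. set_coord k t x \<in> ball 0 r} \<or>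
        (\<forall>lam::real. lam \<noteq> 0 \<longrightarrow>
          norm (osc_integral k f \<phi> lam x)
            \<le> A x * ((SUP t. norm (\<phi> (set_coord k t x)))
                     + (LINT t|lborel. norm (partial_deriv k \<phi> (set_coord k t x))))
              * \<bar>lam\<bar> powr (- 1 / real p))"
      using A[of x] unfolding line_estimate_def by blast
  qed
qed

end
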